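(* Let $\mathcal{J}$ be Pitts' local operator (defined in the context). The $\mathcal{J}$-decidable subsets of $\mathbb{N}$ are precisely the hyperarithmetical ($\Delta^1_1$) subsets of $\mathbb{N}$, and the $\mathcal{J}$-representable functions $\mathbb{N}\to\mathbb{N}$ are precisely the hyperarithmetical functions $\mathbb{N}\to\mathbb{N}$.
   Context: Notation. Fix a recursive coding $\langle a_0,\ldots,a_{n-1}\rangle$ of finite sequences of natural numbers, with recursive length function and recursive projections $(\cdot)_i$. $\phi_e$ is the partial recursive function with index $e$. For $A,B\subseteq\mathbb{N}$: $A\to B$ is the set of indices $e$ such that for every $a\in A$, $\phi_e(a)$ is defined and $\phi_e(a)\in B$; $A\wedge B=\{\langle a,b\rangle \mid a\in A, b\in B\}$; ${\uparrow}n=\{m\in\mathbb{N}\mid n\le m\}$. Pitts' local operator. Define $\mathcal{F}:\mathcal{P}(\mathbb{N})\to\mathcal{P}(\mathbb{N})$ by $\mathcal{F}A=\bigcup_{n\in\mathbb{N}}({\uparrow}n\to A)$, and $\mathcal{J}:\mathcal{P}(\mathbb{N})\to\mathcal{P}(\mathbb{N})$ by $$\mathcal{J}A=\bigcap\{B\subseteq\mathbb{N}\mid \{0\}\wedge A\subseteq B\text{ and }\{1\}\wedge\mathcal{F}B\subseteq B\}.$$ A subset $A\subseteq\mathbb{N}$ is $\mathcal{J}$-decidable if there is a total recursive function $F$ such that $F(n)\in\mathcal{J}\{0\}$ if $n\in A$, and $F(n)\in\mathcal{J}\{1\}$ if $n\notin A$. A function $f:\mathbb{N}\to\mathbb{N}$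 is $\mathcal{J}$-representable if there is a total recursive function $F$ such that $F(n)\in\mathcal{J}\{f(n)\}$ for all $n\in\mathbb{N}$. A subset $A\subseteq\mathbb{N}$ is $\Pi^1_1$ if $A=\{x\mid\forall X\,\psi(X,x)\}$ for a formula of second-order arithmetic in which $\forall X$ is the only second-order quantifier; it is $\Sigma^1_1$ if its complement is $\Pi^1_1$; it is hyperarithmetical ($\Delta^1_1$) if it is both. A function $f:\mathbb{N}\to\mathbb{N}$ is hyperarithmetical if $\{\langle n,f(n)\rangle\mid n\in\mathbb{N}\}$ is a hyperarithmetical set. *)

theory Defs
  imports Main "HOL-Library.Nat_Bijection"
begin

text \<open>The recursive coding of finite sequences used throughout is \<^const>\<open>list_encode\<close>; in
  particular the pair of \<open>a\<close> and \<open>b\<close> is \<^term>\<open>list_encode [a, b]\<close>, not a value of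
  \<^const>\<open>prod_encode\<close>.\<close>

datatype recf =
    Zero
  | Succ
  | Proj nat
  | Comp recf "recf list"
  | Prec recf recf
  | Mu recf

text \<open>Programs carry no arity: they act on argument lists of any length, and are undefined on
  lists that are too short. Composition is strict in all its arguments. In primitive recursion the
  recursion variable is the first argument, and the step function receives the previous index, the
  previous value and the parameters, in this order. Minimisation runs over the first argument and
  needs all values before the zero to be defined.\<close>

fun eval :: "recf \<Rightarrow> nat list \<Rightarrow> nat option" where
  "eval Zero xs = Some 0"
| "eval Succ xs = (case xs of [] \<Rightarrow> None | x # _ \<Rightarrow> Some (Suc x))"
| "eval (Proj i) xs = (if i < length xs then Some (xs ! i) else None)"
| "eval (Comp f gs) xs =
    Option.bind (those (map (\<lambda>g. eval g xs) gs)) (\<lambda>ys. eval f ys)"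
| "eval (Prec f g) xs =
    (case xs of [] \<Rightarrow> None
     | x # ps \<Rightarrow> rec_nat (eval f ps) (\<lambda>n r. Option.bind r (\<lambda>v. eval g (n # v # ps))) x)"
| "eval (Mu f) xs =
    (if \<exists>z. eval f (z # xs) = Some 0 \<and> (\<forall>y<z. \<exists>v>0. eval f (y # xs) = Some v)
     then Some (LEAST z. eval f (z # xs) = Some 0)
     else None)"

fun encode :: "recf \<Rightarrow> nat" where
  "encode Zero = list_encode [0]"
| "encode Succ = list_encode [1]"
| "encode (Proj i) = list_encode [2, i]"
| "encode (Comp f gs) = list_encode (3 # encode f # map encode gs)"
| "encode (Prec f g) = list_encode [4, encode f, encode g]"
| "encode (Mu f) = list_encode [5, encode f]"

lemma encode_eqD: "encode p = encode q \<Longrightarrow> p = q"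
proof (induction p arbitrary: q)
  case (Comp f gs)
  then obtain f' gs' where q: "q = Comp f' gs'"
    by (cases q) (auto simp: list_encode_eq)
  with Comp.prems have f: "encode f = encode f'" and gs: "map encode gs = map encode gs'"
    by (auto simp: list_encode_eq)
  have "gs = gs'"
    using gs Comp.IH(2) by (metis (mono_tags, lifting) length_map list_eq_iff_nth_eq nth_map nth_mem)
  with f Comp.IH(1) q show ?case by simp
next
  case Zero then show ?case by (cases q) (auto simp: list_encode_eq)
next
  case Succ then show ?case by (cases q) (auto simp: list_encode_eq)
next
  case (Proj i) then show ?case by (cases q) (auto simp: list_encode_eq)
next
  case (Prec f g) then show ?case by (cases q) (auto simp: list_encode_eq)
next
  case (Mu f) then show ?case by (cases q) (auto simp: list_encode_eq)
qed

lemma inj_encode: "inj encode"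
  by (rule injI) (rule encode_eqD)

text \<open>Numbers that code no program are indices of the nowhere defined function.\<close>

definition phi :: "nat \<Rightarrow> nat \<Rightarrow> nat option" where
  "phi e x = (if e \<in> range encode then eval (inv encode e) [x] else None)"

lemma phi_encode [simp]: "phi (encode p) x = eval p [x]"
  by (simp add: phi_def inv_f_f[OF inj_encode])

definition total_recursive :: "(nat \<Rightarrow> nat) \<Rightarrow> bool" where
  "total_recursive F \<longleftrightarrow> (\<exists>e. \<forall>n. phi e n = Some (F n))"

definition arrow :: "nat set \<Rightarrow> nat set \<Rightarrow> nat set" where
  "arrow A B = {e. \<forall>a\<in>A. \<exists>b\<in>B. phi e a = Some b}"

definition wedge :: "nat set \<Rightarrow> nat set \<Rightarrow> nat set" where
  "wedge A B = {list_encode [a, b] | a b. a \<in> A \<and> b \<in> B}"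

definition pitts_F :: "nat set \<Rightarrow> nat set" where
  "pitts_F A = (\<Union>n. arrow {n..} A)"

definition pitts_J :: "nat set \<Rightarrow> nat set" where
  "pitts_J A = \<Inter> {B. wedge {0} A \<subseteq> B \<and> wedge {1} (pitts_F B) \<subseteq> B}"

definition J_decidable :: "nat set \<Rightarrow> bool" where
  "J_decidable A \<longleftrightarrow>
    (\<exists>F. total_recursive F \<and>
      (\<forall>n. (n \<in> A \<longrightarrow> F n \<in> pitts_J {0}) \<and> (n \<notin> A \<longrightarrow> F n \<in> pitts_J {1})))"

definition J_representable :: "(nat \<Rightarrow> nat) \<Rightarrow> bool" where
  "J_representable f \<longleftrightarrow> (\<exists>F. total_recursive F \<and> (\<forall>n. F n \<in> pitts_J {f n}))"

text \<open>The language of second-order arithmetic, with its standard (full) classical semantics;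
  the remaining connectives and the existential quantifiers are definable. Number variables and
  set variables are named by natural numbers, independently of each other.\<close>

datatype trm =
    TVar nat
  | TZero
  | TSuc trm
  | TPlus trm trm
  | TTimes trm trm

datatype fml =
    Eq trm trm
  | Less trm trm
  | Mem trm nat
  | Neg fml
  | Conj fml fml
  | All nat fml
  | AllSet nat fml

fun trm_val :: "(nat \<Rightarrow> nat) \<Rightarrow> trm \<Rightarrow> nat" where
  "trm_val v (TVar i) = v i"
| "trm_val v TZero = 0"
| "trm_val v (TSuc t) = Suc (trm_val v t)"
| "trm_val v (TPlus t u) = trm_val v t + trm_val v u"
| "trm_val v (TTimes t u) = trm_val v t * trm_val v u"

fun sat :: "(nat \<Rightarrow> nat) \<Rightarrow> (nat \<Rightarrow> nat set) \<Rightarrow> fml \<Rightarrow> bool" where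
  "sat v S (Eq t u) \<longleftrightarrow> trm_val v t = trm_val v u"
| "sat v S (Less t u) \<longleftrightarrow> trm_val v t < trm_val v u"
| "sat v S (Mem t i) \<longleftrightarrow> trm_val v t \<in> S i"
| "sat v S (Neg p) \<longleftrightarrow> \<not> sat v S p"
| "sat v S (Conj p q) \<longleftrightarrow> sat v S p \<and> sat v S q"
| "sat v S (All i p) \<longleftrightarrow> (\<forall>x. sat (v(i := x)) S p)"
| "sat v S (AllSet i p) \<longleftrightarrow> (\<forall>X. sat v (S(i := X)) p)"

fun trm_vars :: "trm \<Rightarrow> nat set" where
  "trm_vars (TVar i) = {i}"
| "trm_vars TZero = {}"
| "trm_vars (TSuc t) = trm_vars t"
| "trm_vars (TPlus t u) = trm_vars t \<union> trm_vars u"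
| "trm_vars (TTimes t u) = trm_vars t \<union> trm_vars u"

fun free_num_vars :: "fml \<Rightarrow> nat set" where
  "free_num_vars (Eq t u) = trm_vars t \<union> trm_vars u"
| "free_num_vars (Less t u) = trm_vars t \<union> trm_vars u"
| "free_num_vars (Mem t i) = trm_vars t"
| "free_num_vars (Neg p) = free_num_vars p"
| "free_num_vars (Conj p q) = free_num_vars p \<union> free_num_vars q"
| "free_num_vars (All i p) = free_num_vars p - {i}"
| "free_num_vars (AllSet i p) = free_num_vars p"

fun free_set_vars :: "fml \<Rightarrow> nat set" where
  "free_set_vars (Eq t u) = {}"
| "free_set_vars (Less t u) = {}"
| "free_set_vars (Mem t i) = {i}"
| "free_set_vars (Neg p) = free_set_vars p"
| "free_set_vars (Conj p q) = free_set_vars p \<union> free_set_vars q"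
| "free_set_vars (All i p) = free_set_vars p"
| "free_set_vars (AllSet i p) = free_set_vars p - {i}"

fun arithmetical :: "fml \<Rightarrow> bool" where
  "arithmetical (Eq t u) \<longleftrightarrow> True"
| "arithmetical (Less t u) \<longleftrightarrow> True"
| "arithmetical (Mem t i) \<longleftrightarrow> True"
| "arithmetical (Neg p) \<longleftrightarrow> arithmetical p"
| "arithmetical (Conj p q) \<longleftrightarrow> arithmetical p \<and> arithmetical q"
| "arithmetical (All i p) \<longleftrightarrow> arithmetical p"
| "arithmetical (AllSet i p) \<longleftrightarrow> False"

text \<open>The formula has no free set variables and at most the number variable 0 free, so only the
  value of that variable matters. In particular no set parameters are allowed (lightface).\<close>

definition Pi11 :: "nat set \<Rightarrow> bool" where
  "Pi11 A \<longleftrightarrow>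
    (\<exists>\<psi>. arithmetical \<psi> \<and>
         free_num_vars (AllSet 0 \<psi>) \<subseteq> {0} \<and> free_set_vars (AllSet 0 \<psi>) = {} \<and>
         A = {x. sat ((\<lambda>_. 0)(0 := x)) (\<lambda>_. {}) (AllSet 0 \<psi>)})"

definition Sigma11 :: "nat set \<Rightarrow> bool" where
  "Sigma11 A \<longleftrightarrow> Pi11 (- A)"

definition hyperarithmetical :: "nat set \<Rightarrow> bool" where
  "hyperarithmetical A \<longleftrightarrow> Pi11 A \<and> Sigma11 A"

definition hyperarithmetical_fun :: "(nat \<Rightarrow> nat) \<Rightarrow> bool" where
  "hyperarithmetical_fun f \<longleftrightarrow> hyperarithmetical {list_encode [n, f n] | n. True}"

end

theory Submission
  imports Defs "HOL-Library.Countable"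
begin

text \<open>
  An element of \<open>J A\<close> describes a well-founded tree: a leaf \<open>[0, a]\<close> carries an answer \<open>a \<in> A\<close>, and
  a node \<open>[1, e]\<close> has the subtrees \<open>\<phi>\<^sub>e(m)\<close>, of which all but finitely many have to be in
  \<open>J A\<close>. So a realizer may ask for a sequence \<open>m\<^sub>0, m\<^sub>1, \<dots>\<close> of numbers, each as large as it wants, and
  has to answer after finitely many questions. The theorem thus says that the hyperarithmetical
  functions are those that can be computed from every sufficiently fast growing sequence.

  From hyperarithmetical to representable. A universal set quantifier \<open>\<forall>X \<psi>(X, x)\<close> holds iff the tree of
  attempts to refute it has no infinite branch. Branches are taken to be truth valuations: functions
  that assign to each pair of a subformula and a valuation of the number variables either
  ``true'' or ``false with a witness \<open>w\<close>'', subject to conditions that each inspect finitely many values.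
  An infinite branch is the same as a set \<open>X\<close> with \<open>\<not> \<psi>(X, x)\<close> (lemma
  \<open>sat_AllSet_iff_no_refutation\<close>). Given \<open>m\<^sub>0, m\<^sub>1, \<dots>\<close>, prune the tree by allowing only values \<open>\<le> m\<^sub>i\<close> at place
  \<open>i\<close>. If the universal statement is true, the pruned tree is finite by Koenig's lemma, and some level
  is seen to be empty (\<open>eventually_exhausted\<close>); if it is false and the \<open>m\<^sub>i\<close> dominate an
  infinite branch, no level is ever empty (\<open>never_exhausted\<close>). Let \<open>f\<close> have a \<open>\<Pi>\<^sup>1\<^sub>1\<close> graph. Among the trees
  that belong to the statements \<open>f x = j\<close>, for \<open>j = 0, 1, 2, \<dots>\<close>, exactly one is well-founded. Asking
  for numbers until one of the trees is exhausted, and answering its index, is therefore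
  correct whenever the \<open>m\<^sub>i\<close> dominate a branch of each of the other trees. All of them can be dominated
  at once, because tree number \<open>j\<close> is pruned by \<open>m\<^sub>j, m\<^sub>j\<^sub>+\<^sub>1, \<dots>\<close> only, so that the bound on \<open>m\<^sub>i\<close> comes from
  finitely many trees (\<open>J_representable_if_unique_well_founded\<close>). A set \<open>A\<close> is decided in the same
  way, by racing the tree for \<open>x \<in> A\<close> against the tree for \<open>x \<notin> A\<close>.

  From representable to hyperarithmetical. \<open>J\<close> is defined by a monotone inductive definition on top of
  evaluation of programs, which is itself inductive. Both are combined into one set of closure
  conditions on a single set \<open>X\<close> of coded facts. The conditions are first-order in \<open>X\<close>, and a monotone
  statement about the least such \<open>X\<close> is equivalent to the statement for all such \<open>X\<close>, so that it is
  \<open>\<Pi>\<^sup>1\<^sub>1\<close>. If \<open>F\<close> represents \<open>f\<close>, then \<open>f n = k\<close> iff \<open>F n \<in> J {k}\<close>,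
  and \<open>f n \<noteq> k\<close> iff \<open>F n \<in> J (- {k})\<close>, since \<open>J\<close> maps disjoint sets to disjoint sets
  (\<open>pitts_J_disjoint\<close>); both conditions are \<open>\<Pi>\<^sup>1\<^sub>1\<close>.
\<close>

section \<open>Recursive functions of finitely many variables\<close>

text \<open>Functions of several variables are functions of an environment \<open>e\<close> whose variable \<open>i\<close> is \<open>e i\<close>. One
  program has to work for all sufficiently long initial segments of the environment, so no
  arity needs to be fixed. A bound variable of a recursion or of a bounded quantifier becomes
  variable 0, and the others move up by one, which is why \<open>\<lambda>i. e (Suc i)\<close> occurs in the closure
  properties below: their premises can be read off by unification.\<close>

definition rec_fun :: "((nat \<Rightarrow> nat) \<Rightarrow> nat) \<Rightarrow> bool" where
  "rec_fun f \<longleftrightarrow> (\<exists>p n. \<forall>k\<ge>n. \<forall>e. eval p (map e [0..<k]) = Some (f e))"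

lemma those_map_Some: "(\<And>x. x \<in> set xs \<Longrightarrow> f x = Some (g x)) \<Longrightarrow> those (map f xs) = Some (map g xs)"
  by (induction xs) auto

lemma rec_fun_var: "rec_fun (\<lambda>e. e i)"
  unfolding rec_fun_def by (intro exI[of _ "Proj i"] exI[of _ "Suc i"]) auto

lemma map_env_Cons: "map (case_nat a e) [0..<Suc k] = a # map e [0..<k]"
  by (simp add: upt_conv_Cons map_Suc_upt[symmetric] comp_def del: upt_Suc)

lemma those_projections:
  assumes "k \<le> l"
  shows "those (map (\<lambda>g. eval g (map e [0..<l])) (map Proj [0..<k])) = Some (map e [0..<k])"
proof -
  have "those (map (\<lambda>i. eval (Proj i) (map e [0..<l])) [0..<k]) = Some (map e [0..<k])"
    using assms by (intro those_map_Some) auto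
  then show ?thesis by (simp add: comp_def)
qed

lemma rec_fun_Let:
  assumes "rec_fun a" and "rec_fun (\<lambda>e. F (e 0) (\<lambda>i. e (Suc i)))"
  shows "rec_fun (\<lambda>e. F (a e) e)"
proof -
  obtain p n where p: "\<And>k e. k \<ge> n \<Longrightarrow> eval p (map e [0..<k]) = Some (a e)"
    using assms(1) unfolding rec_fun_def by blast
  obtain q l where q: "\<And>k e. k \<ge> l \<Longrightarrow> eval q (map e [0..<k]) = Some (F (e 0) (\<lambda>i. e (Suc i)))"
    using assms(2) unfolding rec_fun_def by blast
  let ?r = "Comp q (p # map Proj [0..<l])"
  have "eval ?r (map e [0..<k]) = Some (F (a e) e)" if "k \<ge> max n l" for k e
    using that p[of k e] q[of "Suc l" "case_nat (a e) e"] those_projections[of l k e]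
    by (simp add: map_env_Cons del: upt_Suc)
  then show ?thesis unfolding rec_fun_def by blast
qed

lemma rec_fun_rec_nat:
  assumes "rec_fun a" and "rec_fun b" and "rec_fun (\<lambda>e. G (e 0) (e (Suc 0)) (\<lambda>i. e (Suc (Suc i))))"
  shows "rec_fun (\<lambda>e. rec_nat (a e) (\<lambda>n r. G n r e) (b e))"
proof -
  obtain p n where p: "\<And>k e. k \<ge> n \<Longrightarrow> eval p (map e [0..<k]) = Some (a e)"
    using assms(1) unfolding rec_fun_def by blast
  obtain q l where q: "\<And>k e. k \<ge> l \<Longrightarrow> eval q (map e [0..<k]) = Some (b e)"
    using assms(2) unfolding rec_fun_def by blast
  obtain g h where g: "\<And>k e. k \<ge> h \<Longrightarrow> eval g (map e [0..<k]) = Some (G (e 0) (e (Suc 0)) (\<lambda>i. e (Suc (Suc i))))"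
    using assms(3) unfolding rec_fun_def by blast
  define N where "N = max n (max l h)"
  let ?r = "Comp (Prec p g) (q # map Proj [0..<N])"
  have "eval ?r (map e [0..<k]) = Some (rec_nat (a e) (\<lambda>n r. G n r e) (b e))" if "k \<ge> N" for k e
  proof -
    have *: "eval (Prec p g) (x # map e [0..<N]) = Some (rec_nat (a e) (\<lambda>n r. G n r e) x)" for x
    proof (induction x)
      case 0
      then show ?case using p[of N e] by (simp add: N_def)
    next
      case (Suc x)
      then show ?case
        using g[of "Suc (Suc N)" "case_nat x (case_nat (rec_nat (a e) (\<lambda>n r. G n r e) x) e)"]
        by (simp add: map_env_Cons N_def del: upt_Suc)
    qed
    have "eval q (map e [0..<k]) = Some (b e)" using q that by (simp add: N_def)
    then show ?thesis using *[of "b e"] those_projections[OF that, of e] by (simp del: upt_Suc)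
  qed
  then show ?thesis unfolding rec_fun_def by blast
qed

text \<open>Programs with a fixed number of arguments are needed where program codes are computed. Missing
  arguments are padded with 0.\<close>

lemma rec_fun_program:
  assumes "rec_fun f"
  obtains p where "\<And>xs. length xs = m \<Longrightarrow> eval p xs = Some (f (\<lambda>i. if i < m then xs ! i else 0))"
proof -
  obtain p n where p: "\<And>k e. k \<ge> n \<Longrightarrow> eval p (map e [0..<k]) = Some (f e)"
    using assms unfolding rec_fun_def by blast
  let ?gs = "map (\<lambda>i. if i < m then Proj i else Zero) [0..<n]"
  have "eval (Comp p ?gs) xs = Some (f (\<lambda>i. if i < m then xs ! i else 0))" if "length xs = m" for xs
  proof -
    have "those (map (\<lambda>i. eval (if i < m then Proj i else Zero) xs) [0..<n])
      = Some (map (\<lambda>i. if i < m then xs ! i else 0) [0..<n])"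
      using that by (intro those_map_Some) auto
    then show ?thesis using p[of n "\<lambda>i. if i < m then xs ! i else 0"] by (simp add: comp_def)
  qed
  then show ?thesis using that by blast
qed

lemma rec_fun_Suc: "rec_fun a \<Longrightarrow> rec_fun (\<lambda>e. Suc (a e))"
proof -
  have "rec_fun (\<lambda>e. Suc (e 0))"
    unfolding rec_fun_def
    by (intro exI[of _ Succ] exI[of _ 1]) (auto simp: upt_conv_Cons)
  then show "rec_fun a \<Longrightarrow> ?thesis" using rec_fun_Let[of a "\<lambda>x e. Suc x"] by simp
qed

lemma rec_fun_const: "rec_fun (\<lambda>e. n)"
proof (induction n)
  case 0
  show ?case unfolding rec_fun_def by (intro exI[of _ Zero]) auto
qed (rule rec_fun_Suc)

lemma rec_fun_pred: "rec_fun a \<Longrightarrow> rec_fun (\<lambda>e. a e - 1)"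
proof -
  have "rec_nat 0 (\<lambda>n r. n) k = k - 1" for k by (cases k) auto
  then show "rec_fun a \<Longrightarrow> ?thesis"
    using rec_fun_rec_nat[OF rec_fun_const[of 0], of a "\<lambda>n r e. n"] rec_fun_var by simp
qed

lemma rec_fun_add: "rec_fun a \<Longrightarrow> rec_fun b \<Longrightarrow> rec_fun (\<lambda>e. a e + b e)"
proof -
  have "rec_nat x (\<lambda>n r. Suc r) y = x + y" for x y by (induction y) auto
  then show "rec_fun a \<Longrightarrow> rec_fun b \<Longrightarrow> ?thesis"
    using rec_fun_rec_nat[of a b "\<lambda>n r e. Suc r"] rec_fun_Suc[OF rec_fun_var] by simp
qed

lemma rec_fun_diff: "rec_fun a \<Longrightarrow> rec_fun b \<Longrightarrow> rec_fun (\<lambda>e. a e - b e)"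
proof -
  have "rec_nat x (\<lambda>n r. r - 1) y = x - y" for x y by (induction y) auto
  then show "rec_fun a \<Longrightarrow> rec_fun b \<Longrightarrow> ?thesis"
    using rec_fun_rec_nat[of a b "\<lambda>n r e. r - 1"] rec_fun_pred[OF rec_fun_var] by simp
qed

lemma rec_fun_rename:
  assumes "rec_fun b"
  shows "rec_fun (\<lambda>e. b (\<lambda>i. e (r i)))"
proof -
  obtain p n where p: "\<And>k e. k \<ge> n \<Longrightarrow> eval p (map e [0..<k]) = Some (b e)"
    using assms unfolding rec_fun_def by blast
  obtain m where m: "\<forall>i<n. r i < m"
    using finite_nat_set_iff_bounded[of "r ` {..<n}"] by auto
  have "eval (Comp p (map (\<lambda>i. Proj (r i)) [0..<n])) (map e [0..<k]) = Some (b (\<lambda>i. e (r i)))"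
    if "k \<ge> m" for k e
  proof -
    have "those (map (\<lambda>i. eval (Proj (r i)) (map e [0..<k])) [0..<n])
      = Some (map (\<lambda>i. e (r i)) [0..<n])"
      using m that by (intro those_map_Some) force
    then show ?thesis using p[of n "\<lambda>i. e (r i)"] by (simp add: comp_def)
  qed
  then show ?thesis unfolding rec_fun_def by blast
qed

text \<open>Bounded sums serve below for multiplication, bounded quantifiers and bounded search.\<close>

lemma rec_fun_sum:
  assumes "rec_fun b" and "rec_fun (\<lambda>e. F (e 0) (\<lambda>i. e (Suc i)))"
  shows "rec_fun (\<lambda>e. \<Sum>z<b e. F z e)"
proof -
  have "rec_fun (\<lambda>e. F (e 0) (\<lambda>i. e (Suc (Suc i))))"
    using rec_fun_rename[OF assms(2), of "case_nat 0 (\<lambda>i. Suc (Suc i))"] by simp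
  then have *: "rec_fun (\<lambda>e. e (Suc 0) + F (e 0) (\<lambda>i. e (Suc (Suc i))))"
    by (intro rec_fun_add rec_fun_var)
  have "rec_nat 0 (\<lambda>n r. r + F n e) y = (\<Sum>z<y. F z e)" for y e by (induction y) auto
  then show ?thesis
    using rec_fun_rec_nat[OF rec_fun_const[of 0] assms(1), of "\<lambda>n r e. r + F n e"] * by simp
qed

lemma rec_fun_mult:
  assumes "rec_fun a" and "rec_fun b"
  shows "rec_fun (\<lambda>e. a e * b e)"
proof -
  have "rec_fun (\<lambda>e. \<Sum>z<a e. b e)"
    using assms(1) rec_fun_rename[OF assms(2), of Suc] by (rule rec_fun_sum)
  then show ?thesis by simp
qed

lemma rec_fun_subst3:
  assumes "rec_fun (\<lambda>e. F (e 0) (e (Suc 0)) (e (Suc (Suc 0))))"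
    and "rec_fun a" and "rec_fun b" and "rec_fun c"
  shows "rec_fun (\<lambda>e. F (a e) (b e) (c e))"
proof -
  obtain p n where p: "\<And>k e. k \<ge> n \<Longrightarrow> eval p (map e [0..<k]) = Some (a e)"
    using assms(2) unfolding rec_fun_def by blast
  obtain q l where q: "\<And>k e. k \<ge> l \<Longrightarrow> eval q (map e [0..<k]) = Some (b e)"
    using assms(3) unfolding rec_fun_def by blast
  obtain r m where r: "\<And>k e. k \<ge> m \<Longrightarrow> eval r (map e [0..<k]) = Some (c e)"
    using assms(4) unfolding rec_fun_def by blast
  obtain f where f: "\<And>xs. length xs = Suc (Suc (Suc 0)) \<Longrightarrow>
      eval f xs = Some (F (xs ! 0) (xs ! Suc 0) (xs ! Suc (Suc 0)))"
    using rec_fun_program[OF assms(1), of "Suc (Suc (Suc 0))"] by auto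
  have "eval (Comp f [p, q, r]) (map e [0..<k]) = Some (F (a e) (b e) (c e))"
    if "k \<ge> n + l + m" for k e
    using that p[of k e] q[of k e] r[of k e] f[of "[a e, b e, c e]"] by simp
  then show ?thesis unfolding rec_fun_def by blast
qed

definition rec_pred :: "((nat \<Rightarrow> nat) \<Rightarrow> bool) \<Rightarrow> bool" where
  "rec_pred P \<longleftrightarrow> rec_fun (\<lambda>e. of_bool (P e))"

lemma rec_pred_less:
  assumes "rec_fun a" and "rec_fun b"
  shows "rec_pred (\<lambda>e. a e < b e)"
proof -
  have "(\<lambda>e. of_bool (a e < b e) :: nat) = (\<lambda>e. 1 - (1 - (b e - a e)))" by auto
  moreover have "rec_fun (\<lambda>e. 1 - (1 - (b e - a e)))"
    using assms by (intro rec_fun_diff rec_fun_const)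
  ultimately show ?thesis unfolding rec_pred_def by (simp only:)
qed

lemma rec_pred_not:
  assumes "rec_pred P"
  shows "rec_pred (\<lambda>e. \<not> P e)"
proof -
  have "(\<lambda>e. of_bool (\<not> P e) :: nat) = (\<lambda>e. 1 - of_bool (P e))"
    by (simp add: fun_eq_iff)
  moreover have "rec_fun (\<lambda>e. 1 - of_bool (P e))"
    using assms unfolding rec_pred_def by (intro rec_fun_diff rec_fun_const)
  ultimately show ?thesis unfolding rec_pred_def by (simp only:)
qed

lemma rec_pred_conj: "rec_pred P \<Longrightarrow> rec_pred Q \<Longrightarrow> rec_pred (\<lambda>e. P e \<and> Q e)"
  unfolding rec_pred_def of_bool_conj by (rule rec_fun_mult)

lemma rec_pred_disj:
  assumes "rec_pred P" and "rec_pred Q"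
  shows "rec_pred (\<lambda>e. P e \<or> Q e)"
  using rec_pred_not[OF rec_pred_conj[OF rec_pred_not[OF assms(1)] rec_pred_not[OF assms(2)]]] by simp

lemma rec_pred_imp:
  assumes "rec_pred P" and "rec_pred Q"
  shows "rec_pred (\<lambda>e. P e \<longrightarrow> Q e)"
  using rec_pred_disj[OF rec_pred_not[OF assms(1)] assms(2)] by (simp only: imp_conv_disj)

lemma rec_pred_iff:
  assumes "rec_pred P" and "rec_pred Q"
  shows "rec_pred (\<lambda>e. P e \<longleftrightarrow> Q e)"
  unfolding iff_conv_conj_imp using assms by (intro rec_pred_conj rec_pred_imp)

lemma rec_pred_le:
  assumes "rec_fun a" and "rec_fun b"
  shows "rec_pred (\<lambda>e. a e \<le> b e)"
  using rec_pred_not[OF rec_pred_less[OF assms(2,1)]] by (simp only: not_less)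

lemma rec_pred_eq:
  assumes "rec_fun a" and "rec_fun b"
  shows "rec_pred (\<lambda>e. a e = b e)"
  unfolding eq_iff using assms by (intro rec_pred_conj rec_pred_le)

lemma rec_pred_const: "rec_pred (\<lambda>e. P)"
  unfolding rec_pred_def by (rule rec_fun_const)

lemma rec_pred_bex:
  assumes "rec_fun b" and "rec_pred (\<lambda>e. P (e 0) (\<lambda>i. e (Suc i)))"
  shows "rec_pred (\<lambda>e. \<exists>z<b e. P z e)"
proof -
  have "rec_fun (\<lambda>e. \<Sum>z<b e. of_bool (P z e))"
    using assms unfolding rec_pred_def by (intro rec_fun_sum)
  then have "rec_pred (\<lambda>e. 0 < (\<Sum>z<b e. of_bool (P z e) :: nat))"
    by (intro rec_pred_less rec_fun_const)
  moreover have "(0 < (\<Sum>z<b e. of_bool (P z e) :: nat)) = (\<exists>z<b e. P z e)" for e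
    by (metis (mono_tags, lifting) finite_lessThan lessThan_iff not_gr_zero of_bool_eq_0_iff sum_eq_0_iff)
  ultimately show ?thesis by simp
qed

lemma rec_pred_ball:
  assumes "rec_fun b" and "rec_pred (\<lambda>e. P (e 0) (\<lambda>i. e (Suc i)))"
  shows "rec_pred (\<lambda>e. \<forall>z<b e. P z e)"
  using rec_pred_not[OF rec_pred_bex[OF assms(1), of "\<lambda>z e. \<not> P z e"]] rec_pred_not[OF assms(2)] by simp

lemma rec_fun_If:
  assumes "rec_pred P" and "rec_fun a" and "rec_fun b"
  shows "rec_fun (\<lambda>e. if P e then a e else b e)"
proof -
  have "(\<lambda>e. if P e then a e else b e) = (\<lambda>e. of_bool (P e) * a e + of_bool (\<not> P e) * b e)"
    by (simp add: fun_eq_iff)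
  moreover have "rec_fun (\<lambda>e. of_bool (P e) * a e + of_bool (\<not> P e) * b e)"
    using assms rec_pred_not[OF assms(1)] unfolding rec_pred_def
    by (intro rec_fun_add rec_fun_mult)
  ultimately show ?thesis by simp
qed

lemma rec_fun_triangle:
  assumes "rec_fun a"
  shows "rec_fun (\<lambda>e. triangle (a e))"
proof -
  have "triangle n = (\<Sum>z<Suc n. z)" for n
    by (induction n) auto
  moreover have "rec_fun (\<lambda>e. \<Sum>z<Suc (a e). z)"
    using assms by (intro rec_fun_sum rec_fun_Suc rec_fun_var)
  ultimately show ?thesis by (simp only:)
qed

lemma rec_fun_prod_encode: "rec_fun a \<Longrightarrow> rec_fun b \<Longrightarrow> rec_fun (\<lambda>e. prod_encode (a e, b e))"
  unfolding prod_encode_def by (simp, intro rec_fun_add rec_fun_triangle)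

lemmas rec_intros = rec_fun_Suc rec_fun_const rec_fun_add rec_fun_diff rec_fun_mult
  rec_fun_prod_encode rec_fun_If rec_fun_sum rec_pred_less rec_pred_not rec_pred_conj rec_pred_disj
  rec_pred_imp rec_pred_iff rec_pred_le rec_pred_eq rec_pred_bex rec_pred_ball

section \<open>Sequences coded as nested pairs\<close>

text \<open>Every number codes an infinite sequence: \<open>y\<close> is read as \<open>(head, tail)\<close>. Since 0 decodes to \<open>(0, 0)\<close>,
  nested pairs that end in 0 are finite sequences continued by zeros. This code serves both for
  valuations of the number variables and for the sequences of numbers a realizer has received.\<close>

definition shd :: "nat \<Rightarrow> nat" where "shd y = fst (prod_decode y)"
definition stl :: "nat \<Rightarrow> nat" where "stl y = snd (prod_decode y)"

lemma shd_prod_encode [simp]: "shd (prod_encode (a, b)) = a"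
  and stl_prod_encode [simp]: "stl (prod_encode (a, b)) = b"
  by (simp_all add: shd_def stl_def)

lemma prod_encode_shd_stl [simp]: "prod_encode (shd y, stl y) = y"
  by (simp add: shd_def stl_def)

lemma shd_le: "shd y \<le> y" and stl_le: "stl y \<le> y"
  by (metis prod_encode_shd_stl le_prod_encode_1, metis prod_encode_shd_stl le_prod_encode_2)

lemma sum_of_bool_unique:
  fixes F :: "nat \<Rightarrow> nat"
  assumes "a < n" and "\<And>z. P z \<longleftrightarrow> z = a"
  shows "(\<Sum>z<n. of_bool (P z) * F z) = F a"
proof -
  have "(\<Sum>z<n. of_bool (P z) * F z) = (\<Sum>z<n. if z = a then F z else 0)"
    by (intro sum.cong) (auto simp: assms(2))
  then show ?thesis using assms(1) by simp
qed

text \<open>The only nonzero summand of \<open>\<Sum>z<b e. of_bool (P z e) * z\<close> is the value searched for.\<close>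

lemma rec_fun_search:
  assumes "rec_fun b" and "rec_pred (\<lambda>e. P (e 0) (\<lambda>i. e (Suc i)))"
    and "\<And>e. f e < b e" and "\<And>e z. P z e \<longleftrightarrow> z = f e"
  shows "rec_fun f"
proof -
  have "rec_fun (\<lambda>e. \<Sum>z<b e. of_bool (P z e) * z)"
    using assms(1,2) unfolding rec_pred_def by (intro rec_fun_sum rec_fun_mult rec_fun_var)
  moreover have "(\<Sum>z<b e. of_bool (P z e) * z) = f e" for e
    using assms(3,4) by (intro sum_of_bool_unique[where F = "\<lambda>z. z"])
  ultimately show ?thesis by simp
qed

lemma shd_eq_iff: "z = shd y \<longleftrightarrow> (\<exists>w<Suc y. prod_encode (z, w) = y)"
  by (metis le_imp_less_Suc prod_encode_shd_stl shd_prod_encode stl_le)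

lemma stl_eq_iff: "z = stl y \<longleftrightarrow> (\<exists>w<Suc y. prod_encode (w, z) = y)"
  by (metis le_imp_less_Suc prod_encode_shd_stl stl_prod_encode shd_le)

lemma rec_fun_shd:
  assumes "rec_fun a"
  shows "rec_fun (\<lambda>e. shd (a e))"
proof -
  have graph: "rec_pred (\<lambda>e. \<exists>w<Suc (e (Suc 0)). prod_encode (e 0, w) = e (Suc 0))"
    by (intro rec_intros rec_fun_var)
  have "rec_fun (\<lambda>e. shd (e 0))"
    by (rule rec_fun_search[of "\<lambda>e. Suc (e 0)" "\<lambda>z e. \<exists>w<Suc (e 0). prod_encode (z, w) = e 0"])
      (simp only: rec_fun_Suc rec_fun_var, simp only: graph,
        simp only: less_Suc_eq_le shd_le, simp only: shd_eq_iff)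
  then show ?thesis using rec_fun_Let[OF assms, of "\<lambda>x e. shd x"] by simp
qed

lemma rec_fun_stl:
  assumes "rec_fun a"
  shows "rec_fun (\<lambda>e. stl (a e))"
proof -
  have graph: "rec_pred (\<lambda>e. \<exists>w<Suc (e (Suc 0)). prod_encode (w, e 0) = e (Suc 0))"
    by (intro rec_intros rec_fun_var)
  have "rec_fun (\<lambda>e. stl (e 0))"
    by (rule rec_fun_search[of "\<lambda>e. Suc (e 0)" "\<lambda>z e. \<exists>w<Suc (e 0). prod_encode (w, z) = e 0"])
      (simp only: rec_fun_Suc rec_fun_var, simp only: graph,
        simp only: less_Suc_eq_le stl_le, simp only: stl_eq_iff)
  then show ?thesis using rec_fun_Let[OF assms, of "\<lambda>x e. stl x"] by simp
qed

definition snth :: "nat \<Rightarrow> nat \<Rightarrow> nat" where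
  "snth y i = shd (rec_nat y (\<lambda>_. stl) i)"

lemma snth_0 [simp]: "snth y 0 = shd y"
  by (simp add: snth_def)

lemma snth_Suc [simp]: "snth y (Suc i) = snth (stl y) i"
proof -
  have "rec_nat y (\<lambda>_. stl) (Suc i) = rec_nat (stl y) (\<lambda>_. stl) i" by (induction i) auto
  then show ?thesis by (simp only: snth_def)
qed

lemma rec_fun_snth: "rec_fun a \<Longrightarrow> rec_fun b \<Longrightarrow> rec_fun (\<lambda>e. snth (a e) (b e))"
  unfolding snth_def by (intro rec_fun_shd rec_fun_rec_nat rec_fun_stl rec_fun_var)

fun supd :: "nat \<Rightarrow> nat \<Rightarrow> nat \<Rightarrow> nat" where
  "supd 0 a y = prod_encode (a, stl y)"
| "supd (Suc i) a y = prod_encode (shd y, supd i a (stl y))"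

lemma snth_supd: "snth (supd i a y) = (snth y)(i := a)"
proof (rule ext)
  show "snth (supd i a y) j = ((snth y)(i := a)) j" for j
  proof (induction i arbitrary: j y)
    case 0 then show ?case by (cases j) auto
  next
    case (Suc i) then show ?case by (cases j) auto
  qed
qed

lemma rec_fun_supd: "rec_fun a \<Longrightarrow> rec_fun y \<Longrightarrow> rec_fun (\<lambda>e. supd i (a e) (y e))"
  by (induction i arbitrary: y) (auto intro!: rec_fun_prod_encode rec_fun_shd rec_fun_stl)

lemma rec_fun_trm_val: "rec_fun y \<Longrightarrow> rec_fun (\<lambda>e. trm_val (snth (y e)) t)"
  by (induction t) (auto intro!: rec_intros rec_fun_snth)

text \<open>A realizer extends its sequence by pairing, so the most recent of the \<open>k\<close> numbers comes first;
  \<open>entry k y\<close> restores the order in which they arrived.\<close>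

definition entry :: "nat \<Rightarrow> nat \<Rightarrow> nat \<Rightarrow> nat" where
  "entry k y i = (if i < k then snth y (k - Suc i) else 0)"

lemma entry_Cons: "i \<le> k \<Longrightarrow> entry (Suc k) (prod_encode (m, y)) i = (if i = k then m else entry k y i)"
  unfolding entry_def
  by (cases "i = k") (auto simp: Suc_diff_Suc[symmetric] le_less)

lemma rec_fun_entry: "rec_fun k \<Longrightarrow> rec_fun y \<Longrightarrow> rec_fun i \<Longrightarrow> rec_fun (\<lambda>e. entry (k e) (y e) (i e))"
  unfolding entry_def by (intro rec_intros rec_fun_snth)

lemma prod_encode_mono: "a \<le> b \<Longrightarrow> c \<le> d \<Longrightarrow> prod_encode (a, c) \<le> prod_encode (b, d)"
proof -
  have "mono triangle" by (rule mono_iff_le_Suc[THEN iffD2]) simp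
  then show "a \<le> b \<Longrightarrow> c \<le> d \<Longrightarrow> ?thesis"
    unfolding prod_encode_def by (simp add: add_mono monoD)
qed

text \<open>This makes the search for a bounded sequence a bounded search for its code: pairing is
  monotone, so a sequence dominated entry by entry has a smaller code.\<close>

lemma entries_realized:
  "(\<forall>i<k. h i \<le> entry k y i) \<Longrightarrow> \<exists>s\<le>y. \<forall>i<k. entry k s i = h i"
proof (induction k arbitrary: y)
  case (Suc k)
  obtain a y' where y: "y = prod_encode (a, y')" using prod_encode_shd_stl by metis
  have "\<forall>i<k. h i \<le> entry k y' i"
  proof (intro allI impI)
    show "h i \<le> entry k y' i" if "i < k" for i
      using Suc.prems[rule_format, of i] that unfolding y by (simp add: entry_Cons)
  qed
  then obtain s where s: "s \<le> y'" "\<forall>i<k. entry k s i = h i" using Suc.IH by blast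
  have "h k \<le> a" using Suc.prems[rule_format, of k] unfolding y by (simp add: entry_Cons)
  then have "prod_encode (h k, s) \<le> y" using s unfolding y by (intro prod_encode_mono)
  moreover have "\<forall>i<Suc k. entry (Suc k) (prod_encode (h k, s)) i = h i"
    using s by (simp add: entry_Cons less_Suc_eq_le)
  ultimately show ?case by blast
next
  case 0
  show ?case by (intro exI[of _ 0]) simp
qed

text \<open>Lowering the length drops the oldest entries, so the same code \<open>y\<close> also presents the tail of the
  sequence that starts at place \<open>j\<close>.\<close>

lemma entry_shift: "i < k - j \<Longrightarrow> entry (k - j) y i = entry k y (i + j)"
proof -
  assume "i < k - j"
  moreover have "k - j - Suc i = k - Suc (i + j)" "i + j < k" using \<open>i < k - j\<close> by arith+
  ultimately show ?thesis by (simp add: entry_def)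
qed

section \<open>Truth valuations with witnesses\<close>

instance trm :: countable by countable_datatype
instance fml :: countable by countable_datatype

text \<open>The place at which a truth valuation stores the truth value of \<open>p\<close> under the valuation of the number
  variables that is coded by \<open>v\<close>.\<close>

definition truth_index :: "fml \<Rightarrow> nat \<Rightarrow> nat" where
  "truth_index p v = prod_encode (to_nat p, v)"

text \<open>The set \<open>X\<close> that a truth valuation describes consists of the \<open>n\<close> for which the valuation makes the
  formula ``variable 0 is in \<open>X\<close>'' true when variable 0 has the value \<open>n\<close>.\<close>

definition mem_index :: "nat \<Rightarrow> nat" where
  "mem_index n = truth_index (Mem (TVar 0) 0) (prod_encode (n, 0))"

text \<open>The values of a truth valuation \<open>h\<close> mean: 0 undefined, 1 true, \<open>w + 2\<close> false, with \<open>w\<close> a counterexample if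
  the formula is a universal quantification. Undefined values make every condition
  vacuous, so that the conditions also make sense for finite initial segments. The number \<open>z\<close> is
  the instance at which true universal quantifications are tested: for each \<open>v\<close> and \<open>z\<close> only
  finitely many values of \<open>h\<close> are inspected.\<close>

fun coherent :: "(nat \<Rightarrow> nat) \<Rightarrow> nat \<Rightarrow> nat \<Rightarrow> fml \<Rightarrow> bool" where
  "coherent h v z (Eq t u) \<longleftrightarrow> 0 < h (truth_index (Eq t u) v) \<longrightarrow>
     (h (truth_index (Eq t u) v) = 1 \<longleftrightarrow> trm_val (snth v) t = trm_val (snth v) u)"
| "coherent h v z (Less t u) \<longleftrightarrow> 0 < h (truth_index (Less t u) v) \<longrightarrow>
     (h (truth_index (Less t u) v) = 1 \<longleftrightarrow> trm_val (snth v) t < trm_val (snth v) u)"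
| "coherent h v z (Mem t i) \<longleftrightarrow> 0 < h (truth_index (Mem t i) v) \<and> 0 < h (mem_index (trm_val (snth v) t)) \<longrightarrow>
     (h (truth_index (Mem t i) v) = 1 \<longleftrightarrow> h (mem_index (trm_val (snth v) t)) = 1)"
| "coherent h v z (Neg p) \<longleftrightarrow> coherent h v z p \<and>
     (0 < h (truth_index (Neg p) v) \<and> 0 < h (truth_index p v) \<longrightarrow> (h (truth_index (Neg p) v) = 1 \<longleftrightarrow> h (truth_index p v) \<noteq> 1))"
| "coherent h v z (Conj p q) \<longleftrightarrow> coherent h v z p \<and> coherent h v z q \<and>
     (0 < h (truth_index (Conj p q) v) \<and> 0 < h (truth_index p v) \<and> 0 < h (truth_index q v) \<longrightarrow>
       (h (truth_index (Conj p q) v) = 1 \<longleftrightarrow> h (truth_index p v) = 1 \<and> h (truth_index q v) = 1))"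
| "coherent h v z (All i p) \<longleftrightarrow> coherent h v z p \<and>
     (h (truth_index (All i p) v) = 1 \<longrightarrow> h (truth_index p (supd i z v)) \<le> 1) \<and>
     (1 < h (truth_index (All i p) v) \<longrightarrow> h (truth_index p (supd i (h (truth_index (All i p) v) - 2) v)) \<noteq> 1)"
| "coherent h v z (AllSet i p) \<longleftrightarrow> True"

lemma coherent_antimono:
  assumes "coherent g v z p" and "\<And>c. h c = 0 \<or> h c = g c"
  shows "coherent h v z p"
  using assms(1)
proof (induction p)
  case (Mem t i)
  then show ?case using assms(2)[of "truth_index (Mem t i) v"] assms(2)[of "mem_index (trm_val (snth v) t)"] by auto
next
  case (Eq t u)
  then show ?case using assms(2)[of "truth_index (Eq t u) v"] by auto
next
  case (Less t u)
  then show ?case using assms(2)[of "truth_index (Less t u) v"] by auto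
next
  case (Neg p)
  then show ?case using assms(2)[of "truth_index (Neg p) v"] assms(2)[of "truth_index p v"] by auto
next
  case (Conj p q)
  then show ?case
    using assms(2)[of "truth_index (Conj p q) v"] assms(2)[of "truth_index p v"] assms(2)[of "truth_index q v"] by auto
next
  case (All i p)
  then show ?case
    using assms(2)[of "truth_index (All i p) v"] assms(2)[of "truth_index p (supd i z v)"]
      assms(2)[of "truth_index p (supd i (h (truth_index (All i p) v) - 2) v)"] by auto
qed auto

text \<open>A total coherent valuation is correct about the set it describes, by induction on the formula. For
  a false universal quantification the stored witness refutes an instance.\<close>

lemma coherent_imp_sat:
  assumes "\<And>c. 0 < h c" and "\<And>v z. coherent h v z p"
    and "arithmetical p" and "free_set_vars p \<subseteq> {0}" and "S 0 = {n. h (mem_index n) = 1}"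
  shows "h (truth_index p v) = 1 \<longleftrightarrow> sat (snth v) S p"
  using assms(2-4)
proof (induction p arbitrary: v)
  case (Eq t u)
  then show ?case using assms(1) by auto
next
  case (Less t u)
  then show ?case using assms(1) by auto
next
  case (Mem t i)
  then have "i = 0" by simp
  then show ?case using Mem.prems(1)[of v] assms(1,5) by simp
next
  case (Neg p)
  then show ?case using assms(1) by auto
next
  case (Conj p q)
  then have "h (truth_index p v) = 1 \<longleftrightarrow> sat (snth v) S p" "h (truth_index q v) = 1 \<longleftrightarrow> sat (snth v) S q"
    by auto
  then show ?case using assms(1) Conj.prems(1)[of v] by auto
next
  case (All i p)
  have IH: "h (truth_index p (supd i a v)) = 1 \<longleftrightarrow> sat ((snth v)(i := a)) S p" for a
  proof -
    have "h (truth_index p (supd i a v)) = 1 \<longleftrightarrow> sat (snth (supd i a v)) S p"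
      by (rule All.IH) (use All.prems in auto)
    then show ?thesis by (simp only: snth_supd)
  qed
  show ?case
  proof (cases "h (truth_index (All i p) v) = 1")
    case True
    then have "h (truth_index p (supd i z v)) = 1" for z
      using All.prems(1)[of v z] assms(1)[of "truth_index p (supd i z v)"] by simp
    then show ?thesis using True IH by simp
  next
    case False
    then have "1 < h (truth_index (All i p) v)" using assms(1)[of "truth_index (All i p) v"] by linarith
    then have "h (truth_index p (supd i (h (truth_index (All i p) v) - 2) v)) \<noteq> 1"
      using All.prems(1)[of v] by simp
    then show ?thesis using False IH by auto
  qed
qed auto

text \<open>The valuation given by actual truth under \<open>S\<close>; the number 2 stands for ``false'' where a
  witness has no meaning.\<close>

definition truth_values :: "(nat \<Rightarrow> nat set) \<Rightarrow> nat \<Rightarrow> nat" where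
  "truth_values S c =
    (let p = from_nat (shd c); v = stl c in
     if sat (snth v) S p then 1
     else case p of All i q \<Rightarrow> (SOME w. \<not> sat ((snth v)(i := w)) S q) + 2 | _ \<Rightarrow> 2)"

lemma truth_values_eq_1_iff [simp]: "truth_values S (truth_index p v) = Suc 0 \<longleftrightarrow> sat (snth v) S p"
  by (auto simp: truth_values_def truth_index_def split: fml.split)

lemma truth_values_gt_0: "0 < truth_values S c"
  by (auto simp: truth_values_def Let_def split: fml.split)

lemma coherent_truth_values:
  assumes "free_set_vars p \<subseteq> {0}" and "arithmetical p"
  shows "coherent (truth_values S) v z p"
  using assms
proof (induction p)
  case (Mem t i)
  then show ?case by (simp add: mem_index_def)
next
  case (All i p)
  show ?case
  proof (cases "sat (snth v) S (All i p)")
    case True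
    then have "truth_values S (truth_index (All i p) v) = 1"
      using truth_values_eq_1_iff[of S "All i p" v] by (simp del: sat.simps)
    moreover have "truth_values S (truth_index p (supd i z v)) = 1"
      using True truth_values_eq_1_iff[of S p "supd i z v"] by (simp add: snth_supd)
    ultimately show ?thesis using All by (simp del: truth_values_eq_1_iff)
  next
    case False
    let ?w = "SOME w. \<not> sat ((snth v)(i := w)) S p"
    have "\<not> sat ((snth v)(i := ?w)) S p"
      using False someI_ex[of "\<lambda>w. \<not> sat ((snth v)(i := w)) S p"] by simp
    then have "truth_values S (truth_index p (supd i ?w v)) \<noteq> 1"
      using truth_values_eq_1_iff[of S p "supd i ?w v"] by (simp add: snth_supd)
    moreover have "truth_values S (truth_index (All i p) v) = ?w + 2"
      using False by (simp add: truth_values_def truth_index_def del: sat.simps)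
    ultimately show ?thesis using All by (simp del: truth_values_eq_1_iff)
  qed
qed auto

text \<open>A condition inspects finitely many values, so it is settled by a long enough initial segment. In
  the universal case the place inspected depends on \<open>h\<close> itself, through the stored witness.\<close>

lemma coherent_local:
  "\<exists>k. \<forall>g. (\<forall>c<k. g c = h c) \<longrightarrow> coherent g v z p = coherent h v z p"
proof (induction p)
  case (Eq t u)
  show ?case by (rule exI[of _ "Suc (truth_index (Eq t u) v)"]) simp
next
  case (Less t u)
  show ?case by (rule exI[of _ "Suc (truth_index (Less t u) v)"]) simp
next
  case (Mem t i)
  show ?case by (rule exI[of _ "Suc (truth_index (Mem t i) v + mem_index (trm_val (snth v) t))"]) simp
next
  case (Neg p)
  then obtain k where k: "\<And>g. \<forall>c<k. g c = h c \<Longrightarrow> coherent g v z p = coherent h v z p" by blast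
  have "coherent g v z (Neg p) = coherent h v z (Neg p)"
    if "\<forall>c<Suc (k + truth_index (Neg p) v + truth_index p v). g c = h c" for g
    using that k[of g] by simp
  then show ?case by blast
next
  case (Conj p q)
  then obtain k l where k: "\<And>g. \<forall>c<k. g c = h c \<Longrightarrow> coherent g v z p = coherent h v z p"
    and l: "\<And>g. \<forall>c<l. g c = h c \<Longrightarrow> coherent g v z q = coherent h v z q" by blast
  have "coherent g v z (Conj p q) = coherent h v z (Conj p q)"
    if "\<forall>c<Suc (k + l + truth_index (Conj p q) v + truth_index p v + truth_index q v). g c = h c" for g
    using that k[of g] l[of g] by simp
  then show ?case by blast
next
  case (All i p)
  then obtain k where k: "\<And>g. \<forall>c<k. g c = h c \<Longrightarrow> coherent g v z p = coherent h v z p" by blast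
  have "coherent g v z (All i p) = coherent h v z (All i p)"
    if "\<forall>c<Suc (k + truth_index (All i p) v + truth_index p (supd i z v)
      + truth_index p (supd i (h (truth_index (All i p) v) - 2) v)). g c = h c" for g
    using that k[of g] by simp
  then show ?case by blast
qed simp

definition cut :: "nat \<Rightarrow> (nat \<Rightarrow> nat) \<Rightarrow> nat \<Rightarrow> nat" where
  "cut k h c = (if c < k then h c else 0)"

text \<open>The first \<open>k\<close> values of \<open>h\<close> form a node of the tree of refutations of \<open>\<forall>X p\<close> at input \<open>x\<close>: no condition
  with \<open>v, z < k\<close> is violated, and \<open>p\<close> is not marked true.\<close>

definition refutes :: "fml \<Rightarrow> nat \<Rightarrow> nat \<Rightarrow> (nat \<Rightarrow> nat) \<Rightarrow> bool" where
  "refutes p x k h \<longleftrightarrow> (\<forall>v<k. \<forall>z<k. coherent (cut k h) v z p) \<and> cut k h (truth_index p (prod_encode (x, 0))) \<noteq> 1"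

lemma refutes_mono:
  assumes "refutes p x l h" and "k \<le> l"
  shows "refutes p x k h"
proof -
  have cut: "\<And>c. cut k h c = 0 \<or> cut k h c = cut l h c"
    using assms(2) by (simp add: cut_def)
  have "coherent (cut k h) v z p" if "v < k" "z < k" for v z
  proof (rule coherent_antimono)
    show "coherent (cut l h) v z p"
      using assms that by (simp add: refutes_def)
  qed (rule cut)
  moreover have "cut k h (truth_index p (prod_encode (x, 0))) \<noteq> 1"
    using assms(1) cut[of "truth_index p (prod_encode (x, 0))"] by (auto simp: refutes_def)
  ultimately show ?thesis by (simp add: refutes_def)
qed

lemma refutes_cong:
  assumes "\<forall>i<k. h i = g i"
  shows "refutes p x k h \<longleftrightarrow> refutes p x k g"
proof -
  have "cut k h = cut k g"
    using assms by (intro ext) (simp add: cut_def)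
  then show ?thesis by (simp add: refutes_def)
qed

lemma snth_zero: "snth 0 = (\<lambda>_. 0)"
proof (rule ext)
  have "prod_decode 0 = (0, 0)" by (simp add: prod_decode_def prod_decode_aux.simps[of 0 0])
  then show "snth 0 i = 0" for i
    by (induction i) (simp_all add: shd_def stl_def)
qed

lemma snth_input: "snth (prod_encode (x, 0)) = (\<lambda>_. 0)(0 := x)"
proof (rule ext)
  show "snth (prod_encode (x, 0)) i = ((\<lambda>_. 0)(0 := x)) i" for i
    by (cases i) (simp_all add: snth_zero)
qed

text \<open>Kleene's normal form: a \<open>\<Pi>\<^sup>1\<^sub>1\<close> statement says that a recursive tree has no infinite branch.
  An infinite branch describes a counterexample \<open>X\<close>, and truth under a counterexample is an infinite
  branch.\<close>

lemma sat_AllSet_iff_no_refutation: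
  assumes "arithmetical p" and "free_set_vars p \<subseteq> {0}"
  shows "sat ((\<lambda>_. 0)(0 := x)) S (AllSet 0 p) \<longleftrightarrow> \<not> (\<exists>h. \<forall>k. (\<forall>i<k. 0 < h i) \<and> refutes p x k h)"
proof
  assume sat: "sat ((\<lambda>_. 0)(0 := x)) S (AllSet 0 p)"
  show "\<not> (\<exists>h. \<forall>k. (\<forall>i<k. 0 < h i) \<and> refutes p x k h)"
  proof
    assume "\<exists>h. \<forall>k. (\<forall>i<k. 0 < h i) \<and> refutes p x k h"
    then obtain h where h: "\<forall>k. (\<forall>i<k. 0 < h i) \<and> refutes p x k h" by blast
    then have pos: "0 < h i" for i by (meson lessI)
    have ref: "refutes p x k h" for k using h by blast
    have "coherent h v z p" for v z
    proof -
      obtain k where "\<And>g. (\<forall>c<k. g c = h c) \<Longrightarrow> coherent g v z p = coherent h v z p"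
        using coherent_local by blast
      moreover have "coherent (cut (Suc (k + v + z)) h) v z p"
        using ref[of "Suc (k + v + z)"] by (simp add: refutes_def)
      moreover have "\<forall>c<k. cut (Suc (k + v + z)) h c = h c" by (simp add: cut_def)
      ultimately show ?thesis by blast
    qed
    then have "h (truth_index p (prod_encode (x, 0))) = 1"
      using coherent_imp_sat[of h p "S(0 := {n. h (mem_index n) = 1})" "prod_encode (x, 0)"]
        pos assms sat by (simp add: snth_input)
    then show False
      using ref[of "Suc (truth_index p (prod_encode (x, 0)))"] by (simp add: refutes_def cut_def)
  qed
next
  assume *: "\<not> (\<exists>h. \<forall>k. (\<forall>i<k. 0 < h i) \<and> refutes p x k h)"
  show "sat ((\<lambda>_. 0)(0 := x)) S (AllSet 0 p)"
  proof (rule ccontr)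
    assume "\<not> ?thesis"
    then obtain X where X: "\<not> sat ((\<lambda>_. 0)(0 := x)) (S(0 := X)) p" by auto
    let ?h = "truth_values (S(0 := X))"
    have "coherent (cut k ?h) v z p" for k v z
      by (rule coherent_antimono[OF coherent_truth_values[OF assms(2,1), of "S(0 := X)"]]) (simp add: cut_def)
    moreover have "cut k ?h (truth_index p (prod_encode (x, 0))) \<noteq> 1" for k
      using X by (simp add: cut_def snth_input)
    ultimately have "\<forall>k. (\<forall>i<k. 0 < ?h i) \<and> refutes p x k ?h"
      using truth_values_gt_0 by (simp add: refutes_def)
    then show False using * by blast
  qed
qed

lemma rec_fun_truth_index: "rec_fun v \<Longrightarrow> rec_fun (\<lambda>e. truth_index p (v e))"
  unfolding truth_index_def by (intro rec_fun_prod_encode rec_fun_const)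

lemma rec_fun_mem_index: "rec_fun a \<Longrightarrow> rec_fun (\<lambda>e. mem_index (a e))"
  unfolding mem_index_def by (intro rec_fun_truth_index rec_fun_prod_encode rec_fun_const)

text \<open>The formula is fixed, so the recursion over it takes place outside the program: each subformula
  contributes a constant number of recursive tests.\<close>

lemma rec_pred_coherent:
  assumes H: "\<And>a. rec_fun a \<Longrightarrow> rec_fun (\<lambda>e. H (a e) e)"
    and v: "rec_fun v" and z: "rec_fun z"
  shows "rec_pred (\<lambda>e. coherent (\<lambda>c. H c e) (v e) (z e) p)"
proof (induction p)
qed (simp_all only: coherent.simps, (intro rec_intros rec_pred_const H rec_fun_truth_index rec_fun_mem_index rec_fun_trm_val rec_fun_supd v z | assumption)+)

section \<open>The tree of refutations of a universal set quantifier\<close>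

definition exhausted :: "fml \<Rightarrow> nat \<Rightarrow> nat \<Rightarrow> nat \<Rightarrow> bool" where
  "exhausted p x k y \<longleftrightarrow> \<not> (\<exists>h. (\<forall>i<k. 0 < h i \<and> h i \<le> entry k y i) \<and> refutes p x k h)"

lemma cut_entry: "cut k (entry k s) = entry k s"
  by (auto simp: cut_def entry_def)

lemma exhausted_iff:
  "exhausted p x k y \<longleftrightarrow> \<not> (\<exists>s<Suc y. (\<forall>i<k. 0 < entry k s i \<and> entry k s i \<le> entry k y i) \<and>
     (\<forall>v<k. \<forall>z<k. coherent (entry k s) v z p) \<and> entry k s (truth_index p (prod_encode (x, 0))) \<noteq> 1)"
proof -
  have "(\<exists>h. (\<forall>i<k. 0 < h i \<and> h i \<le> entry k y i) \<and> refutes p x k h) \<longleftrightarrow>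
    (\<exists>s<Suc y. (\<forall>i<k. 0 < entry k s i \<and> entry k s i \<le> entry k y i) \<and> refutes p x k (entry k s))"
  proof
    assume "\<exists>h. (\<forall>i<k. 0 < h i \<and> h i \<le> entry k y i) \<and> refutes p x k h"
    then obtain h where h: "\<forall>i<k. 0 < h i \<and> h i \<le> entry k y i" "refutes p x k h" by blast
    then obtain s where s: "s \<le> y" "\<forall>i<k. entry k s i = h i" using entries_realized by blast
    then have "refutes p x k (entry k s)" using h(2) refutes_cong by metis
    then show "\<exists>s<Suc y. (\<forall>i<k. 0 < entry k s i \<and> entry k s i \<le> entry k y i) \<and> refutes p x k (entry k s)"
      using h s by (intro exI[of _ s]) auto
  qed blast
  then show ?thesis by (simp only: exhausted_def refutes_def cut_entry)
qed

lemma rec_pred_exhausted: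
  assumes "rec_fun x" and "rec_fun k" and "rec_fun y"
  shows "rec_pred (\<lambda>e. exhausted p (x e) (k e) (y e))"
proof -
  have "rec_pred (\<lambda>e. exhausted p (e 0) (e (Suc 0)) (e (Suc (Suc 0))))"
    unfolding exhausted_iff
    by (intro rec_intros rec_fun_entry rec_pred_coherent rec_fun_truth_index rec_fun_var | assumption)+
  from rec_fun_subst3[OF this[unfolded rec_pred_def] assms] show ?thesis
    unfolding rec_pred_def .
qed

text \<open>Koenig's lemma for trees whose branching at place \<open>i\<close> is bounded by \<open>m i\<close>. The branch is built by
  keeping the invariant \<open>ext\<close>: the segment chosen so far has extensions of every height. If no value at
  place \<open>k\<close> kept it, each of the finitely many allowed values would fail from some height on, and
  the largest of these heights would contradict the invariant.\<close>

lemma koenig: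
  fixes P :: "nat \<Rightarrow> (nat \<Rightarrow> nat) \<Rightarrow> bool"
  assumes nonempty: "\<And>k. \<exists>h. (\<forall>i<k. h i \<le> m i) \<and> P k h"
    and mono: "\<And>k l h. P l h \<Longrightarrow> k \<le> l \<Longrightarrow> P k h"
    and cong: "\<And>k h g. \<forall>i<k. h i = g i \<Longrightarrow> P k h \<Longrightarrow> P k g"
  shows "\<exists>h. \<forall>k. P k h"
proof -
  define ext where "ext k h \<longleftrightarrow> (\<forall>l. \<exists>g. (\<forall>i<k. g i = h i) \<and> (\<forall>i<l. g i \<le> m i) \<and> P l g)" for k h
  have step: "\<exists>a. ext (Suc k) (h(k := a))" if "ext k h" for k h
  proof (rule ccontr)
    assume "\<not> (\<exists>a. ext (Suc k) (h(k := a)))"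
    then have "\<forall>a. \<exists>l. \<forall>g. \<not> ((\<forall>i<Suc k. g i = (h(k := a)) i) \<and> (\<forall>i<l. g i \<le> m i) \<and> P l g)"
      unfolding ext_def not_ex not_all .
    from choice[OF this] obtain L where
      L: "\<forall>a. \<forall>g. \<not> ((\<forall>i<Suc k. g i = (h(k := a)) i) \<and> (\<forall>i<L a. g i \<le> m i) \<and> P (L a) g)"
      by (rule exE)
    define l where "l = Suc k + Max (L ` {..m k})"
    obtain g where g: "\<forall>i<k. g i = h i" "\<forall>i<l. g i \<le> m i" "P l g"
      using \<open>ext k h\<close> unfolding ext_def by blast
    have "g k \<le> m k" using g(2) by (simp add: l_def)
    then have "L (g k) \<le> l" unfolding l_def
      by (meson Max_ge atMost_iff finite_atMost finite_imageI imageI trans_le_add2)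
    have "\<forall>i<Suc k. g i = (h(k := g k)) i" using g(1) by (simp add: less_Suc_eq)
    moreover have "\<forall>i<L (g k). g i \<le> m i" using g(2) \<open>L (g k) \<le> l\<close> by simp
    moreover have "P (L (g k)) g" using g(3) \<open>L (g k) \<le> l\<close> by (rule mono)
    ultimately show False using spec[OF spec[OF L, of "g k"], of g] by (elim notE) (intro conjI)
  qed
  define path where "path = rec_nat (\<lambda>_. 0) (\<lambda>k h. h(k := SOME a. ext (Suc k) (h(k := a))))"
  have path_Suc: "path (Suc k) = (path k)(k := SOME a. ext (Suc k) ((path k)(k := a)))" for k
    by (simp add: path_def)
  have path: "ext k (path k)" for k
  proof (induction k)
    case 0
    show ?case using nonempty by (simp add: ext_def)
  next
    case (Suc k)
    from someI_ex[OF step[OF Suc.IH]] show ?case unfolding path_Suc .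
  qed
  have agree: "i < k \<Longrightarrow> path k i = path (Suc i) i" for i k
    by (induction k) (auto simp: path_Suc less_Suc_eq)
  have "P k (\<lambda>i. path (Suc i) i)" for k
  proof -
    obtain g where g: "\<forall>i<k. g i = path k i" "P k g"
      using path[of k] unfolding ext_def by blast
    have "\<forall>i<k. g i = path (Suc i) i"
    proof (intro allI impI)
      show "g i = path (Suc i) i" if "i < k" for i
        using g(1) that agree[OF that] by simp
    qed
    from cong[OF this g(2)] show ?thesis .
  qed
  then show ?thesis by (intro exI allI)
qed

lemma eventually_exhausted:
  assumes "arithmetical p" and "free_set_vars p \<subseteq> {0}" and "sat ((\<lambda>_. 0)(0 := x)) S (AllSet 0 p)"
  shows "\<exists>k. \<forall>y. (\<forall>i<k. entry k y i = m i) \<longrightarrow> exhausted p x k y"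
proof (rule ccontr)
  assume "\<not> ?thesis"
  then have alive: "\<And>k. \<exists>y. (\<forall>i<k. entry k y i = m i) \<and> \<not> exhausted p x k y" by blast
  have "\<exists>h. \<forall>k. (\<forall>i<k. 0 < h i) \<and> refutes p x k h"
  proof (rule koenig)
    show "\<exists>h. (\<forall>i<k. h i \<le> m i) \<and> (\<forall>i<k. 0 < h i) \<and> refutes p x k h" for k
      using alive[of k] unfolding exhausted_def by metis
    show "(\<forall>i<k. 0 < h i) \<and> refutes p x k h" if "(\<forall>i<l. 0 < h i) \<and> refutes p x l h" "k \<le> l" for k l h
      using that refutes_mono by (meson order_less_le_trans)
    show "(\<forall>i<k. 0 < g i) \<and> refutes p x k g" if "\<forall>i<k. h i = g i" "(\<forall>i<k. 0 < h i) \<and> refutes p x k h" for k h g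
      using that refutes_cong by metis
  qed
  then show False using assms sat_AllSet_iff_no_refutation by blast
qed

lemma never_exhausted:
  assumes "arithmetical p" and "free_set_vars p \<subseteq> {0}" and "\<not> sat ((\<lambda>_. 0)(0 := x)) S (AllSet 0 p)"
  shows "\<exists>b. \<forall>k y. (\<forall>i<k. b i \<le> entry k y i) \<longrightarrow> \<not> exhausted p x k y"
proof -
  obtain h where "\<forall>k. (\<forall>i<k. 0 < h i) \<and> refutes p x k h"
    using assms sat_AllSet_iff_no_refutation by blast
  then show ?thesis unfolding exhausted_def by blast
qed

text \<open>What the realizers use of \<open>\<Pi>\<^sup>1\<^sub>1\<close> sets: a recursive test \<open>E\<close> that for \<open>x \<in> A\<close> succeeds along every
  sequence, and that for \<open>x \<notin> A\<close> never succeeds along sequences above a suitable bound \<open>b\<close>.\<close>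

lemma Pi11_well_foundedness:
  assumes "Pi11 A"
  obtains E where "\<And>x k y. rec_fun x \<Longrightarrow> rec_fun k \<Longrightarrow> rec_fun y \<Longrightarrow> rec_pred (\<lambda>e. E (x e) (k e) (y e))"
    and "\<And>x m. x \<in> A \<Longrightarrow> \<exists>k. \<forall>y. (\<forall>i<k. entry k y i = m i) \<longrightarrow> E x k y"
    and "\<And>x. x \<notin> A \<Longrightarrow> \<exists>b. \<forall>k y. (\<forall>i<k. b i \<le> entry k y i) \<longrightarrow> \<not> E x k y"
proof -
  obtain p where p: "arithmetical p" "free_set_vars (AllSet 0 p) = {}"
    "A = {x. sat ((\<lambda>_. 0)(0 := x)) (\<lambda>_. {}) (AllSet 0 p)}"
    using assms unfolding Pi11_def by blast
  then have free: "free_set_vars p \<subseteq> {0}" by auto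
  show ?thesis
  proof (rule that[of "exhausted p"])
    show "\<exists>k. \<forall>y. (\<forall>i<k. entry k y i = m i) \<longrightarrow> exhausted p x k y" if "x \<in> A" for x m
      using that eventually_exhausted[OF p(1) free] unfolding p(3) by blast
    show "\<exists>b. \<forall>k y. (\<forall>i<k. b i \<le> entry k y i) \<longrightarrow> \<not> exhausted p x k y" if "x \<notin> A" for x
      using that never_exhausted[OF p(1) free] unfolding p(3) by blast
  qed (rule rec_pred_exhausted)
qed

section \<open>The closure operator J\<close>

lemma pitts_J_base: "a \<in> A \<Longrightarrow> list_encode [0, a] \<in> pitts_J A"
  by (auto simp: pitts_J_def wedge_def)

lemma pitts_F_mono: "A \<subseteq> B \<Longrightarrow> pitts_F A \<subseteq> pitts_F B"
  by (fastforce simp: pitts_F_def arrow_def)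

lemma wedge_mono: "A \<subseteq> A' \<Longrightarrow> B \<subseteq> B' \<Longrightarrow> wedge A B \<subseteq> wedge A' B'"
  by (auto simp: wedge_def)

lemma pitts_J_step:
  assumes "\<forall>m\<ge>n. \<exists>b\<in>pitts_J A. phi e m = Some b"
  shows "list_encode [1, e] \<in> pitts_J A"
proof -
  have "list_encode [1, e] \<in> B" if B: "wedge {0} A \<subseteq> B" "wedge {1} (pitts_F B) \<subseteq> B" for B
  proof -
    have "pitts_J A \<subseteq> B" using B by (auto simp: pitts_J_def)
    then have "e \<in> pitts_F B" using assms by (fastforce simp: pitts_F_def arrow_def)
    then show ?thesis using B(2) by (auto simp: wedge_def)
  qed
  then show ?thesis by (auto simp: pitts_J_def)
qed

text \<open>\<open>J A\<close> is the least fixed point of \<open>B \<mapsto> {0} \<and> A \<union> {1} \<and> F B\<close>, hence every element is obtained by one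
  of the two rules.\<close>

lemma pitts_J_cases:
  assumes "x \<in> pitts_J A"
  shows "(\<exists>a\<in>A. x = list_encode [0, a]) \<or> (\<exists>e\<in>pitts_F (pitts_J A). x = list_encode [1, e])"
proof -
  let ?B = "wedge {0} A \<union> wedge {1} (pitts_F (pitts_J A))"
  have "?B \<subseteq> pitts_J A"
  proof -
    have "wedge {1} (pitts_F (pitts_J A)) \<subseteq> pitts_J A"
      using pitts_J_step unfolding wedge_def pitts_F_def arrow_def by blast
    then show ?thesis using pitts_J_base by (auto simp: wedge_def)
  qed
  then have "wedge {1} (pitts_F ?B) \<subseteq> ?B"
    using wedge_mono[OF order_refl pitts_F_mono] by (meson Un_upper2 order_trans)
  then have "pitts_J A \<subseteq> ?B" unfolding pitts_J_def by blast
  then show ?thesis using assms by (auto simp: wedge_def)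
qed

lemma pitts_J_mono: "A \<subseteq> B \<Longrightarrow> pitts_J A \<subseteq> pitts_J B"
  using wedge_mono[of "{0}" "{0}" A B] unfolding pitts_J_def by blast

text \<open>The complement of \<open>J B\<close> is closed under the rules that generate \<open>J A\<close>: if \<open>\<phi>\<^sub>e(m)\<close> were in \<open>J B\<close> for all
  large \<open>m\<close> and outside \<open>J B\<close> for all large \<open>m\<close>, any large \<open>m\<close> would give a contradiction.\<close>

lemma pitts_J_disjoint:
  assumes "A \<inter> B = {}"
  shows "pitts_J A \<inter> pitts_J B = {}"
proof -
  let ?C = "- pitts_J B"
  have base: "wedge {0} A \<subseteq> ?C"
  proof
    fix x assume "x \<in> wedge {0} A"
    then obtain a where "a \<in> A" "x = list_encode [0, a]" by (auto simp: wedge_def)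
    then show "x \<in> ?C" using assms pitts_J_cases[of x B] by (auto simp: list_encode_eq)
  qed
  have "wedge {1} (pitts_F ?C) \<subseteq> ?C"
  proof
    fix x assume "x \<in> wedge {1} (pitts_F ?C)"
    then obtain e where e: "e \<in> pitts_F ?C" "x = list_encode [1, e]" by (auto simp: wedge_def)
    show "x \<in> ?C"
    proof
      assume "x \<in> pitts_J B"
      then have "e \<in> pitts_F (pitts_J B)" using e(2) pitts_J_cases[of x B] by (auto simp: list_encode_eq)
      then obtain n where n: "\<And>m. m \<ge> n \<Longrightarrow> \<exists>b\<in>pitts_J B. phi e m = Some b"
        unfolding pitts_F_def arrow_def by auto
      obtain l where l: "\<And>m. m \<ge> l \<Longrightarrow> \<exists>b\<in>?C. phi e m = Some b"
        using e(1) unfolding pitts_F_def arrow_def by auto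
      show False using n[of "max n l"] l[of "max n l"] by auto
    qed
  qed
  with base have "pitts_J A \<subseteq> ?C" unfolding pitts_J_def by blast
  then show ?thesis by blast
qed

section \<open>Realizers from well-founded trees\<close>

text \<open>The codes of these programs are computable from their values, which gives the s-m-n theorem as
  far as it is needed below.\<close>

fun numeral_prog :: "nat \<Rightarrow> recf" where
  "numeral_prog 0 = Zero"
| "numeral_prog (Suc n) = Comp Succ [numeral_prog n]"

lemma eval_numeral_prog [simp]: "eval (numeral_prog n) xs = Some n"
  by (induction n) auto

lemma rec_fun_encode_numeral_prog:
  assumes "rec_fun a"
  shows "rec_fun (\<lambda>e. encode (numeral_prog (a e)))"
proof -
  have "encode (numeral_prog n) = rec_nat (encode Zero) (\<lambda>_ r. list_encode [3, encode Succ, r]) n" for n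
    by (induction n) auto
  moreover have "rec_fun (\<lambda>e. rec_nat (encode Zero) (\<lambda>_ r. list_encode [3, encode Succ, r]) (a e))"
    by (intro rec_fun_rec_nat rec_fun_const assms)
      (simp only: list_encode.simps, intro rec_intros rec_fun_var)
  ultimately show ?thesis by simp
qed

text \<open>\<open>R x k y\<close> is the realizer after the \<open>k\<close> numbers coded by \<open>y\<close> have been received: it stops with answer \<open>a\<close>
  if \<open>D x k y = a + 1\<close>, and asks for a further number if \<open>D x k y = 0\<close>. In the second case it has to
  return an index of \<open>m \<mapsto> R x (k + 1) (m, y)\<close>, which mentions \<open>R\<close> itself. The recursion theorem is
  avoided by a program \<open>q\<close> that takes a program code as an additional first argument, to be supplied with
  its own code.\<close>

lemma bar_program:
  fixes D :: "nat \<Rightarrow> nat \<Rightarrow> nat \<Rightarrow> nat"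
  assumes D: "rec_fun (\<lambda>e. D (e 0) (e (Suc 0)) (e (Suc (Suc 0))))"
  obtains R :: "nat \<Rightarrow> nat \<Rightarrow> nat \<Rightarrow> nat"
  where "total_recursive (\<lambda>x. R x 0 0)"
    and "\<And>x k y a. D x k y = Suc a \<Longrightarrow> R x k y = list_encode [0, a]"
    and "\<And>x k y. D x k y = 0 \<Longrightarrow>
      \<exists>i. R x k y = list_encode [1, i] \<and> (\<forall>m. phi i m = Some (R x (Suc k) (prod_encode (m, y))))"
proof -
  have "rec_fun (\<lambda>e. prod_encode (e 0, e (Suc 0)))"
    by (intro rec_intros rec_fun_var)
  from rec_fun_program[OF this, of "Suc (Suc 0)"] obtain c where
    c: "\<And>xs. length xs = Suc (Suc 0) \<Longrightarrow> eval c xs = Some (prod_encode (xs ! 0, xs ! Suc 0))"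
    by auto
  \<comment> \<open>The code, computed by hand, of the program that prepends the constants \<open>q\<close>, \<open>x\<close>, \<open>k + 1\<close> and calls
    the program coded by \<open>q\<close>.\<close>
  define next_index where "next_index q x k y =
    list_encode [3, q, encode (numeral_prog q), encode (numeral_prog x), encode (numeral_prog (Suc k)),
      list_encode [3, encode c, encode (Proj 0), encode (numeral_prog y)]]" for q x k y
  have "rec_fun (\<lambda>e. if D (e (Suc 0)) (e (Suc (Suc 0))) (e (Suc (Suc (Suc 0)))) = 0
      then list_encode [1, next_index (e 0) (e (Suc 0)) (e (Suc (Suc 0))) (e (Suc (Suc (Suc 0))))]
      else list_encode [0, D (e (Suc 0)) (e (Suc (Suc 0))) (e (Suc (Suc (Suc 0)))) - 1])" (is "rec_fun ?r")
    unfolding next_index_def list_encode.simps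
    by (intro rec_intros rec_fun_var rec_fun_encode_numeral_prog rec_fun_rename[OF D, of Suc])
  from rec_fun_program[OF this, of "Suc (Suc (Suc (Suc 0)))"] obtain q where
    q: "\<And>xs. length xs = Suc (Suc (Suc (Suc 0))) \<Longrightarrow>
      eval q xs = Some (?r (\<lambda>i. if i < Suc (Suc (Suc (Suc 0))) then xs ! i else 0))"
    by blast
  define R where "R x k y = (if D x k y = 0 then list_encode [1, next_index (encode q) x k y]
    else list_encode [0, D x k y - 1])" for x k y
  have eval_q: "eval q [encode q, x, k, y] = Some (R x k y)" for x k y
    using q[of "[encode q, x, k, y]"] by (simp add: R_def)
  show ?thesis
  proof (rule that[of R])
    have "phi (encode (Comp q [numeral_prog (encode q), Proj 0, Zero, Zero])) x = Some (R x 0 0)" for x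
      unfolding phi_encode by (simp add: eval_q)
    then show "total_recursive (\<lambda>x. R x 0 0)" unfolding total_recursive_def by blast
    show "R x k y = list_encode [0, a]" if "D x k y = Suc a" for x k y a
      using that by (simp add: R_def)
    show "\<exists>i. R x k y = list_encode [1, i] \<and> (\<forall>m. phi i m = Some (R x (Suc k) (prod_encode (m, y))))"
      if "D x k y = 0" for x k y
    proof (intro exI conjI allI)
      show "R x k y = list_encode [1, next_index (encode q) x k y]"
        using that by (simp add: R_def)
      have "next_index (encode q) x k y = encode (Comp q [numeral_prog (encode q), numeral_prog x,
          numeral_prog (Suc k), Comp c [Proj 0, numeral_prog y]])"
        by (simp add: next_index_def)
      then show "phi (next_index (encode q) x k y) m = Some (R x (Suc k) (prod_encode (m, y)))" for m
        using c[of "[m, y]"] by (simp add: eval_q del: encode.simps numeral_prog.simps)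
    qed
  qed
qed

text \<open>Bar induction by contradiction. If \<open>R 0 0\<close> were not in \<open>J {a}\<close>, then at every stage one could choose
  a further number, as large as \<open>b\<close> demands, such that the next realizer is not in \<open>J {a}\<close> either, since
  otherwise the current one would be. Along the resulting sequence \<open>D\<close> never stops, against \<open>bar\<close>.\<close>

lemma in_pitts_J_if_barred:
  assumes stop: "\<And>k y a. D k y = Suc a \<Longrightarrow> R k y = list_encode [0, a]"
    and step: "\<And>k y. D k y = 0 \<Longrightarrow>
      \<exists>i. R k y = list_encode [1, i] \<and> (\<forall>m. phi i m = Some (R (Suc k) (prod_encode (m, y))))"
    and val: "\<And>k y. \<forall>i<k. b i \<le> entry k y i \<Longrightarrow> D k y = 0 \<or> D k y = Suc a"
    and bar: "\<And>m. \<exists>k. \<forall>y. (\<forall>i<k. entry k y i = m i) \<longrightarrow> D k y \<noteq> 0"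
  shows "R 0 0 \<in> pitts_J {a}"
proof (rule ccontr)
  assume "R 0 0 \<notin> pitts_J {a}"
  define bad where "bad k y \<longleftrightarrow> (\<forall>i<k. b i \<le> entry k y i) \<and> R k y \<notin> pitts_J {a}" for k y
  have bad_D: "D k y = 0" if "bad k y" for k y
  proof -
    have "D k y \<noteq> Suc a"
      using that stop pitts_J_base[of a "{a}"] unfolding bad_def by auto
    then show ?thesis using that val unfolding bad_def by blast
  qed
  have extend: "\<exists>m. bad (Suc k) (prod_encode (m, y))" if "bad k y" for k y
  proof (rule ccontr)
    assume none: "\<not> ?thesis"
    obtain i where i: "R k y = list_encode [1, i]" "\<And>m. phi i m = Some (R (Suc k) (prod_encode (m, y)))"
      using step[OF bad_D[OF \<open>bad k y\<close>]] by blast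
    have "R (Suc k) (prod_encode (m, y)) \<in> pitts_J {a}" if "b k \<le> m" for m
    proof -
      have "\<forall>i<Suc k. b i \<le> entry (Suc k) (prod_encode (m, y)) i"
        using \<open>bad k y\<close> that by (simp add: entry_Cons less_Suc_eq_le bad_def)
      then show ?thesis using none unfolding bad_def by blast
    qed
    then have "R k y \<in> pitts_J {a}"
      unfolding i(1) by (intro pitts_J_step[of "b k"]) (simp add: i(2))
    then show False using that unfolding bad_def by blast
  qed
  define m where "m k y = (SOME m. bad (Suc k) (prod_encode (m, y)))" for k y
  define path where "path = rec_nat 0 (\<lambda>k y. prod_encode (m k y, y))"
  have path_Suc: "path (Suc k) = prod_encode (m k (path k), path k)" for k
    by (simp add: path_def)
  have bad_path: "bad k (path k)" for k
  proof (induction k)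
    case 0
    show ?case using \<open>R 0 0 \<notin> pitts_J {a}\<close> by (simp add: bad_def path_def)
  next
    case (Suc k)
    from someI_ex[OF extend[OF Suc.IH]] show ?case unfolding path_Suc m_def .
  qed
  have "\<forall>i<k. entry k (path k) i = m i (path i)" for k
    by (induction k) (simp_all add: path_Suc entry_Cons less_Suc_eq_le le_less)
  then show False using bar[of "\<lambda>i. m i (path i)"] bad_D[OF bad_path] by blast
qed

text \<open>Tree number \<open>j\<close> is tested at height \<open>k - j\<close>, which prunes it by the numbers from place \<open>j\<close> on.
  The index found is increased by one to leave 0 for ``none yet''.\<close>

definition first_exhausted :: "(nat \<Rightarrow> nat \<Rightarrow> nat \<Rightarrow> bool) \<Rightarrow> nat \<Rightarrow> nat \<Rightarrow> nat" where
  "first_exhausted E k y =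
    (\<Sum>j<Suc k. of_bool (E j (k - j) y \<and> (\<forall>i<j. \<not> E i (k - i) y)) * Suc j)"

lemma first_exhausted_cases:
  shows "first_exhausted E k y = 0 \<and> (\<forall>j\<le>k. \<not> E j (k - j) y) \<or>
    (\<exists>j\<le>k. first_exhausted E k y = Suc j \<and> E j (k - j) y)"
proof (cases "\<exists>j\<le>k. E j (k - j) y")
  case True
  then obtain j where j: "j \<le> k" "E j (k - j) y" "\<And>i. i < j \<Longrightarrow> \<not> E i (k - i) y"
    using exists_least_iff[of "\<lambda>j. j \<le> k \<and> E j (k - j) y"] by (metis le_trans less_imp_le)
  have "first_exhausted E k y = Suc j"
    unfolding first_exhausted_def
  proof (rule sum_of_bool_unique)
    show "j < Suc k" using j(1) by simp
    show "(E z (k - z) y \<and> (\<forall>i<z. \<not> E i (k - i) y)) \<longleftrightarrow> z = j" for z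
      using j(2,3) by (metis linorder_neqE_nat)
  qed
  then show ?thesis using j by blast
next
  case False
  then have "first_exhausted E k y = 0"
    unfolding first_exhausted_def by (intro sum.neutral) (simp add: less_Suc_eq_le)
  then show ?thesis using False by blast
qed

text \<open>For each \<open>x\<close> there is a family of trees, of which \<open>E x j\<close> recognises the exhaustion, and only the tree
  with index \<open>f x\<close> is well-founded. Race all of them and answer the index of the first that is exhausted.\<close>

lemma J_representable_if_unique_well_founded:
  assumes rec: "\<And>x j k y. rec_fun x \<Longrightarrow> rec_fun j \<Longrightarrow> rec_fun k \<Longrightarrow> rec_fun y \<Longrightarrow>
      rec_pred (\<lambda>e. E (x e) (j e) (k e) (y e))"
    and found: "\<And>x m. \<exists>k. \<forall>y. (\<forall>i<k. entry k y i = m i) \<longrightarrow> E x (f x) k y"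
    and others: "\<And>x j. j \<noteq> f x \<Longrightarrow> \<exists>b. \<forall>k y. (\<forall>i<k. b i \<le> entry k y i) \<longrightarrow> \<not> E x j k y"
  shows "J_representable f"
proof -
  have "rec_fun (\<lambda>e. first_exhausted (E (e 0)) (e (Suc 0)) (e (Suc (Suc 0))))"
    unfolding first_exhausted_def
    by (intro rec_fun_sum rec_fun_mult rec_fun_Suc rec_fun_var)
      (simp only: rec_pred_def[symmetric],
        intro rec_pred_conj rec rec_pred_ball rec_pred_not rec_fun_var rec_fun_diff)
  then obtain R where R: "total_recursive (\<lambda>x. R x 0 0)"
    and stop: "\<And>x k y a. first_exhausted (E x) k y = Suc a \<Longrightarrow> R x k y = list_encode [0, a]"
    and step: "\<And>x k y. first_exhausted (E x) k y = 0 \<Longrightarrow>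
      \<exists>i. R x k y = list_encode [1, i] \<and> (\<forall>m. phi i m = Some (R x (Suc k) (prod_encode (m, y))))"
    by (rule bar_program[of "\<lambda>x. first_exhausted (E x)"]) blast
  have "R x 0 0 \<in> pitts_J {f x}" for x
  proof -
    have "\<forall>j. \<exists>b. j \<noteq> f x \<longrightarrow> (\<forall>k y. (\<forall>i<k. b i \<le> entry k y i) \<longrightarrow> \<not> E x j k y)"
      using others by blast
    from choice[OF this] obtain b where
      b: "\<And>j k y. j \<noteq> f x \<Longrightarrow> \<forall>i<k. b j i \<le> entry k y i \<Longrightarrow> \<not> E x j k y"
      by blast
    \<comment> \<open>A sequence above \<open>bound\<close> dominates \<open>b j\<close>, shifted by \<open>j\<close> places, for every \<open>j\<close>; place \<open>i\<close> only has to
      respect the finitely many \<open>j \<le> i\<close>.\<close>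
    define bound where "bound i = (\<Sum>j\<le>i. b j (i - j))" for i
    show ?thesis
    proof (rule in_pitts_J_if_barred[of "first_exhausted (E x)" "R x" bound "f x"])
      show "first_exhausted (E x) k y = 0 \<or> first_exhausted (E x) k y = Suc (f x)"
        if y: "\<forall>i<k. bound i \<le> entry k y i" for k y
      proof -
        have "\<not> E x j (k - j) y" if "j \<noteq> f x" for j
        proof (rule b[OF that], intro allI impI)
          fix i assume "i < k - j"
          have "b j i \<le> bound (i + j)"
            unfolding bound_def using member_le_sum[of j "{..i + j}" "\<lambda>l. b l (i + j - l)"] by simp
          also have "\<dots> \<le> entry k y (i + j)" using y \<open>i < k - j\<close> by simp
          finally show "b j i \<le> entry (k - j) y i" using \<open>i < k - j\<close> by (simp add: entry_shift)
        qed
        then show ?thesis using first_exhausted_cases[of "E x" k y] by metis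
      qed
      show "\<exists>k. \<forall>y. (\<forall>i<k. entry k y i = m i) \<longrightarrow> first_exhausted (E x) k y \<noteq> 0" for m
      proof -
        obtain k where k: "\<And>y. \<forall>i<k. entry k y i = m (i + f x) \<Longrightarrow> E x (f x) k y"
          using found[of "\<lambda>i. m (i + f x)" x] by blast
        have "first_exhausted (E x) (k + f x) y \<noteq> 0" if "\<forall>i<k + f x. entry (k + f x) y i = m i" for y
        proof -
          have "E x (f x) k y"
            by (rule k) (use that entry_shift[of _ "k + f x" "f x" y] in simp)
          then have "E x (f x) (k + f x - f x) y" by simp
          then show ?thesis using first_exhausted_cases[of "E x" "k + f x" y] by (metis le_add2 Zero_not_Suc)
        qed
        then show ?thesis by blast
      qed
    qed (use stop step in auto)
  qed
  then show ?thesis using R unfolding J_representable_def by blast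
qed

lemma hyperarithmetical_fun_imp_J_representable:
  assumes "hyperarithmetical_fun f"
  shows "J_representable f"
proof -
  let ?G = "{list_encode [n, f n] | n. True}"
  have "Pi11 ?G" using assms by (simp add: hyperarithmetical_fun_def hyperarithmetical_def)
  then obtain E where
    E: "\<And>x k y. rec_fun x \<Longrightarrow> rec_fun k \<Longrightarrow> rec_fun y \<Longrightarrow> rec_pred (\<lambda>e. E (x e) (k e) (y e))"
    and found: "\<And>x m. x \<in> ?G \<Longrightarrow> \<exists>k. \<forall>y. (\<forall>i<k. entry k y i = m i) \<longrightarrow> E x k y"
    and others: "\<And>x. x \<notin> ?G \<Longrightarrow> \<exists>b. \<forall>k y. (\<forall>i<k. b i \<le> entry k y i) \<longrightarrow> \<not> E x k y"
    by (rule Pi11_well_foundedness) blast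
  show ?thesis
  proof (rule J_representable_if_unique_well_founded[of "\<lambda>n j. E (list_encode [n, j])"])
    show "rec_pred (\<lambda>e. E (list_encode [x e, j e]) (k e) (y e))"
      if "rec_fun x" "rec_fun j" "rec_fun k" "rec_fun y" for x j k y
      unfolding list_encode.simps using that by (intro E rec_intros)
    show "\<exists>k. \<forall>y. (\<forall>i<k. entry k y i = m i) \<longrightarrow> E (list_encode [x, f x]) k y" for x m
      by (rule found) blast
    show "\<exists>b. \<forall>k y. (\<forall>i<k. b i \<le> entry k y i) \<longrightarrow> \<not> E (list_encode [x, j]) k y"
      if "j \<noteq> f x" for x j
      by (rule others) (use that list_encode_eq in fastforce)
  qed
qed

lemma hyperarithmetical_imp_J_decidable:
  assumes "hyperarithmetical A"
  shows "J_decidable A"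
proof -
  have "Pi11 A" "Pi11 (- A)" using assms by (simp_all add: hyperarithmetical_def Sigma11_def)
  obtain E where
    E: "\<And>x k y. rec_fun x \<Longrightarrow> rec_fun k \<Longrightarrow> rec_fun y \<Longrightarrow> rec_pred (\<lambda>e. E (x e) (k e) (y e))"
    "\<And>x m. x \<in> A \<Longrightarrow> \<exists>k. \<forall>y. (\<forall>i<k. entry k y i = m i) \<longrightarrow> E x k y"
    "\<And>x. x \<notin> A \<Longrightarrow> \<exists>b. \<forall>k y. (\<forall>i<k. b i \<le> entry k y i) \<longrightarrow> \<not> E x k y"
    using \<open>Pi11 A\<close> by (rule Pi11_well_foundedness) blast
  obtain E' where
    E': "\<And>x k y. rec_fun x \<Longrightarrow> rec_fun k \<Longrightarrow> rec_fun y \<Longrightarrow> rec_pred (\<lambda>e. E' (x e) (k e) (y e))"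
    "\<And>x m. x \<in> - A \<Longrightarrow> \<exists>k. \<forall>y. (\<forall>i<k. entry k y i = m i) \<longrightarrow> E' x k y"
    "\<And>x. x \<notin> - A \<Longrightarrow> \<exists>b. \<forall>k y. (\<forall>i<k. b i \<le> entry k y i) \<longrightarrow> \<not> E' x k y"
    using \<open>Pi11 (- A)\<close> by (rule Pi11_well_foundedness) blast
  let ?f = "\<lambda>x. if x \<in> A then 0 else Suc 0"
  let ?E = "\<lambda>x j k y. (j = 0 \<and> E x k y) \<or> (j = Suc 0 \<and> E' x k y)"
  have "J_representable ?f"
  proof (rule J_representable_if_unique_well_founded[of ?E])
    show "rec_pred (\<lambda>e. ?E (x e) (j e) (k e) (y e))"
      if "rec_fun x" "rec_fun j" "rec_fun k" "rec_fun y" for x j k y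
      using that by (intro rec_pred_disj rec_pred_conj rec_pred_eq E E' rec_fun_const)
    show "\<exists>k. \<forall>y. (\<forall>i<k. entry k y i = m i) \<longrightarrow> ?E x (?f x) k y" for x m
      using E(2)[of x m] E'(2)[of x m] by (cases "x \<in> A") simp_all
    show "\<exists>b. \<forall>k y. (\<forall>i<k. b i \<le> entry k y i) \<longrightarrow> \<not> ?E x j k y" if "j \<noteq> ?f x" for x j
      using that E(3)[of x] E'(3)[of x] by (cases "x \<in> A"; cases "j = 0"; cases "j = Suc 0") simp_all
  qed
  then obtain F where F: "total_recursive F" "\<And>n. F n \<in> pitts_J {?f n}"
    unfolding J_representable_def by blast
  have "(n \<in> A \<longrightarrow> F n \<in> pitts_J {0}) \<and> (n \<notin> A \<longrightarrow> F n \<in> pitts_J {1})" for n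
    using F(2)[of n] by auto
  then show ?thesis using F(1) unfolding J_decidable_def by blast
qed

section \<open>Evaluation and realizability as an inductive definition\<close>

text \<open>An injective pairing that is a term of the language of arithmetic, unlike \<^const>\<open>prod_encode\<close>,
  which involves a division by two. It codes facts and argument lists.\<close>

definition qpair :: "nat \<Rightarrow> nat \<Rightarrow> nat" where
  "qpair a b = (a + b) * (a + b) + a"

lemma qpair_eq_iff [simp]: "qpair a b = qpair c d \<longleftrightarrow> a = c \<and> b = d"
proof -
  have less: "qpair a b < qpair c d" if "a + b < c + d" for a b c d
  proof -
    have "qpair a b < Suc (a + b) * Suc (a + b)" by (simp add: qpair_def)
    also have "\<dots> \<le> (c + d) * (c + d)" using that by (intro mult_le_mono) auto
    also have "\<dots> \<le> qpair c d" by (simp add: qpair_def)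
    finally show ?thesis .
  qed
  have "a = c \<and> b = d" if "qpair a b = qpair c d"
  proof -
    have "a + b = c + d" using less[of a b c d] less[of c d a b] that by linarith
    moreover from this that have "a = c" by (simp add: qpair_def)
    ultimately show ?thesis by simp
  qed
  then show ?thesis by blast
qed

definition acons :: "nat \<Rightarrow> nat \<Rightarrow> nat" where "acons x l = Suc (qpair x l)"

fun args :: "nat list \<Rightarrow> nat" where
  "args [] = 0"
| "args (x # xs) = acons x (args xs)"

lemma acons_eq_args_iff: "acons x l = args xs \<longleftrightarrow> (\<exists>ys. xs = x # ys \<and> l = args ys)"
  by (cases xs) (auto simp: acons_def)

text \<open>The constructor of \<^const>\<open>list_encode\<close>, in which program codes and realizers are given.\<close>

definition lcons :: "nat \<Rightarrow> nat \<Rightarrow> nat" where "lcons a l = Suc (prod_encode (a, l))"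

lemma list_encode_Cons: "list_encode (x # xs) = lcons x (list_encode xs)"
  by (simp add: lcons_def)

lemma list_encode_pair: "list_encode [a, b] = lcons a (lcons b 0)"
  by (simp add: lcons_def)

text \<open>Coded facts, distinguished by a tag. They say that the program with code \<open>c\<close> has value \<open>v\<close> at the arguments
  \<open>l\<close> (\<open>Ev\<close>), that the programs of a list have the values of a list (\<open>Evs\<close>), that \<open>c\<close> is the code of a
  program (\<open>Pr\<close>) or of a list of programs (\<open>Prs\<close>), and that \<open>b\<close> is an element of \<open>J\<close> of the goal set with
  number \<open>t\<close> (\<open>Re\<close>).\<close>

definition Ev :: "nat \<Rightarrow> nat \<Rightarrow> nat \<Rightarrow> nat" where "Ev c l v = qpair 0 (qpair c (qpair l v))"
definition Evs :: "nat \<Rightarrow> nat \<Rightarrow> nat \<Rightarrow> nat" where "Evs c l v = qpair 1 (qpair c (qpair l v))"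
definition Pr :: "nat \<Rightarrow> nat" where "Pr c = qpair 2 c"
definition Prs :: "nat \<Rightarrow> nat" where "Prs c = qpair 3 c"
definition Re :: "nat \<Rightarrow> nat \<Rightarrow> nat" where "Re t b = qpair 4 (qpair t b)"

lemmas fact_defs = Ev_def Evs_def Pr_def Prs_def Re_def

text \<open>The sets \<open>{k}\<close> and \<open>- {k}\<close> to which \<open>J\<close> is applied, numbered by \<open>2 k\<close> and \<open>2 k + 1\<close>.\<close>

definition goal_set :: "nat \<Rightarrow> nat set" where
  "goal_set t = (if even t then {t div 2} else - {t div 2})"

text \<open>Being a program has to be generated separately, since a primitive recursion is evaluated at 0 without
  looking at its step function: without the premise \<open>Pr g\<close> in \<open>Ev_closed\<close>, numbers that code no program would
  receive values.\<close>

definition Pr_closed :: "nat set \<Rightarrow> bool" where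
  "Pr_closed X \<longleftrightarrow> Pr (lcons 0 0) \<in> X \<and> Pr (lcons 1 0) \<in> X \<and> (\<forall>i. Pr (lcons 2 (lcons i 0)) \<in> X) \<and>
    Prs 0 \<in> X \<and>
    (\<forall>g gs. Pr g \<in> X \<and> Prs gs \<in> X \<longrightarrow> Prs (lcons g gs) \<in> X) \<and>
    (\<forall>f gs. Pr f \<in> X \<and> Prs gs \<in> X \<longrightarrow> Pr (lcons 3 (lcons f gs)) \<in> X) \<and>
    (\<forall>f g. Pr f \<in> X \<and> Pr g \<in> X \<longrightarrow> Pr (lcons 4 (lcons f (lcons g 0))) \<in> X) \<and>
    (\<forall>f. Pr f \<in> X \<longrightarrow> Pr (lcons 5 (lcons f 0)) \<in> X)"

definition Ev_closed :: "nat set \<Rightarrow> bool" where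
  "Ev_closed X \<longleftrightarrow>
    (\<forall>l. Ev (lcons 0 0) l 0 \<in> X) \<and>
    (\<forall>x l. Ev (lcons 1 0) (acons x l) (Suc x) \<in> X) \<and>
    (\<forall>x l. Ev (lcons 2 (lcons 0 0)) (acons x l) x \<in> X) \<and>
    (\<forall>i x l v. Ev (lcons 2 (lcons i 0)) l v \<in> X \<longrightarrow> Ev (lcons 2 (lcons (Suc i) 0)) (acons x l) v \<in> X) \<and>
    (\<forall>l. Evs 0 l 0 \<in> X) \<and>
    (\<forall>g gs l y ys. Ev g l y \<in> X \<and> Evs gs l ys \<in> X \<longrightarrow> Evs (lcons g gs) l (acons y ys) \<in> X) \<and>
    (\<forall>f gs l ys v. Evs gs l ys \<in> X \<and> Ev f ys v \<in> X \<longrightarrow> Ev (lcons 3 (lcons f gs)) l v \<in> X) \<and>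
    (\<forall>f g l v. Ev f l v \<in> X \<and> Pr g \<in> X \<longrightarrow> Ev (lcons 4 (lcons f (lcons g 0))) (acons 0 l) v \<in> X) \<and>
    (\<forall>f g n l r v. Ev (lcons 4 (lcons f (lcons g 0))) (acons n l) r \<in> X \<and>
       Ev g (acons n (acons r l)) v \<in> X \<longrightarrow>
       Ev (lcons 4 (lcons f (lcons g 0))) (acons (Suc n) l) v \<in> X) \<and>
    (\<forall>f l z. Ev f (acons z l) 0 \<in> X \<and> (\<forall>y. y < z \<longrightarrow> (\<exists>v. Ev f (acons y l) (Suc v) \<in> X)) \<longrightarrow>
       Ev (lcons 5 (lcons f 0)) l z \<in> X)"

definition Re_closed :: "nat set \<Rightarrow> bool" where
  "Re_closed X \<longleftrightarrow>
    (\<forall>k. Re (k + k) (lcons 0 (lcons k 0)) \<in> X) \<and>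
    (\<forall>k j. j \<noteq> k \<longrightarrow> Re (Suc (k + k)) (lcons 0 (lcons j 0)) \<in> X) \<and>
    (\<forall>t n e. (\<forall>m. n \<le> m \<longrightarrow> (\<exists>b. Ev e (acons m 0) b \<in> X \<and> Re t b \<in> X)) \<longrightarrow>
       Re t (lcons 1 (lcons e 0)) \<in> X)"

text \<open>A set closed under the rules that contains no false fact about genuine argument lists. It is
  not the least one: a number \<open>l\<close> that codes no argument list satisfies the conditions on \<open>Ev\<close> and \<open>Evs\<close>
  vacuously, which makes closure easy to verify and does no harm, as only argument lists are ever
  asked for.\<close>

definition true_facts :: "nat set" where
  "true_facts =
    {Pr (encode p) | p. True} \<union> {Prs (list_encode (map encode ps)) | ps. True} \<union>
    {Ev (encode p) l v | p l v. \<forall>xs. l = args xs \<longrightarrow> eval p xs = Some v} \<union>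
    {Evs (list_encode (map encode ps)) l w | ps l w. \<forall>xs. l = args xs \<longrightarrow>
       (\<exists>ys. w = args ys \<and> those (map (\<lambda>g. eval g xs) ps) = Some ys)} \<union>
    {Re t b | t b. b \<in> pitts_J (goal_set t)}"

lemma true_facts_iff:
  "Pr c \<in> true_facts \<longleftrightarrow> (\<exists>p. c = encode p)"
  "Prs c \<in> true_facts \<longleftrightarrow> (\<exists>ps. c = list_encode (map encode ps))"
  "Ev c l v \<in> true_facts \<longleftrightarrow> (\<exists>p. c = encode p \<and> (\<forall>xs. l = args xs \<longrightarrow> eval p xs = Some v))"
  "Evs c l w \<in> true_facts \<longleftrightarrow> (\<exists>ps. c = list_encode (map encode ps) \<and> (\<forall>xs. l = args xs \<longrightarrow>
       (\<exists>ys. w = args ys \<and> those (map (\<lambda>g. eval g xs) ps) = Some ys)))"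
  "Re t b \<in> true_facts \<longleftrightarrow> b \<in> pitts_J (goal_set t)"
  unfolding true_facts_def by (auto simp: fact_defs)

lemma encode_lcons:
  "encode Zero = lcons 0 0" "encode Succ = lcons 1 0" "encode (Proj i) = lcons 2 (lcons i 0)"
  "encode (Comp f gs) = lcons 3 (lcons (encode f) (list_encode (map encode gs)))"
  "encode (Prec f g) = lcons 4 (lcons (encode f) (lcons (encode g) 0))"
  "encode (Mu f) = lcons 5 (lcons (encode f) 0)"
  by (simp_all add: lcons_def)

lemma encode_eq_iff: "encode p = encode q \<longleftrightarrow> p = q"
  using encode_eqD by blast

lemma Pr_closed_true_facts: "Pr_closed true_facts"
  unfolding Pr_closed_def true_facts_iff
  by (intro conjI allI impI; (elim conjE exE)?)
    (metis encode_lcons list_encode.simps(1) list_encode_Cons list.simps(8,9))+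

lemma Prec_Suc: "eval (Prec f g) (Suc n # xs) = Option.bind (eval (Prec f g) (n # xs)) (\<lambda>r. eval g (n # r # xs))"
  by simp

lemma eval_Mu_eq_Some:
  assumes "eval f (z # xs) = Some 0" and "\<forall>y<z. \<exists>v. eval f (y # xs) = Some (Suc v)"
  shows "eval (Mu f) xs = Some z"
proof -
  have "(LEAST z. eval f (z # xs) = Some 0) = z"
    using assms by (intro Least_equality) (auto simp: not_less[symmetric])
  moreover have "\<exists>z. eval f (z # xs) = Some 0 \<and> (\<forall>y<z. \<exists>v>0. eval f (y # xs) = Some v)"
    using assms by (intro exI[of _ z]) auto
  ultimately show ?thesis by simp
qed

lemma Ev_closed_true_facts: "Ev_closed true_facts"
  unfolding Ev_closed_def
proof (intro conjI allI impI)
  show "Ev (lcons 0 0) l 0 \<in> true_facts" for l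
    unfolding true_facts_iff by (intro exI[of _ Zero]) (simp add: lcons_def)
  show "Ev (lcons 1 0) (acons x l) (Suc x) \<in> true_facts" for x l
    unfolding true_facts_iff acons_eq_args_iff by (intro exI[of _ Succ]) (auto simp: lcons_def)
  show "Ev (lcons 2 (lcons 0 0)) (acons x l) x \<in> true_facts" for x l
    unfolding true_facts_iff acons_eq_args_iff by (intro exI[of _ "Proj 0"]) (auto simp: lcons_def)
  show "Ev (lcons 2 (lcons (Suc i) 0)) (acons x l) v \<in> true_facts"
    if "Ev (lcons 2 (lcons i 0)) l v \<in> true_facts" for i x l v
  proof -
    have *: "eval (Proj i) xs = Some v" if "l = args xs" for xs
      using \<open>Ev (lcons 2 (lcons i 0)) l v \<in> true_facts\<close> that
      unfolding true_facts_iff encode_lcons(3)[symmetric] encode_eq_iff by blast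
    have "eval (Proj (Suc i)) (x # ys) = Some v" if "l = args ys" for ys
      using *[OF that] by (simp split: if_splits)
    then show ?thesis
      unfolding true_facts_iff acons_eq_args_iff encode_lcons(3)[symmetric] by blast
  qed
  show "Evs 0 l 0 \<in> true_facts" for l
    unfolding true_facts_iff by (intro exI[of _ "[]"]) (auto intro: exI[of _ "[]"])
  show "Evs (lcons g gs) l (acons y ys) \<in> true_facts"
    if "Ev g l y \<in> true_facts \<and> Evs gs l ys \<in> true_facts" for g gs l y ys
  proof -
    from that obtain p ps where p: "g = encode p" "\<And>xs. l = args xs \<Longrightarrow> eval p xs = Some y"
      and ps: "gs = list_encode (map encode ps)"
        "\<And>xs. l = args xs \<Longrightarrow> \<exists>zs. ys = args zs \<and> those (map (\<lambda>g. eval g xs) ps) = Some zs"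
      unfolding true_facts_iff by blast
    show ?thesis unfolding true_facts_iff
    proof (intro exI[of _ "p # ps"] conjI allI impI)
      show "lcons g gs = list_encode (map encode (p # ps))" by (simp add: p ps lcons_def)
      fix xs assume "l = args xs"
      then obtain zs where "ys = args zs" "those (map (\<lambda>g. eval g xs) ps) = Some zs" "eval p xs = Some y"
        using p ps by blast
      then show "\<exists>zs. acons y ys = args zs \<and> those (map (\<lambda>g. eval g xs) (p # ps)) = Some zs"
        by (intro exI[of _ "y # zs"]) simp
    qed
  qed
  show "Ev (lcons 3 (lcons f gs)) l v \<in> true_facts"
    if "Evs gs l ys \<in> true_facts \<and> Ev f ys v \<in> true_facts" for f gs l ys v
  proof -
    from that obtain p ps where p: "f = encode p" "\<And>xs. ys = args xs \<Longrightarrow> eval p xs = Some v"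
      and ps: "gs = list_encode (map encode ps)"
        "\<And>xs. l = args xs \<Longrightarrow> \<exists>zs. ys = args zs \<and> those (map (\<lambda>g. eval g xs) ps) = Some zs"
      unfolding true_facts_iff by blast
    have "eval (Comp p ps) xs = Some v" if "l = args xs" for xs
      using ps(2)[OF that] p(2) by auto
    then show ?thesis unfolding true_facts_iff
      by (intro exI[of _ "Comp p ps"]) (simp add: p(1) ps(1) lcons_def)
  qed
  show "Ev (lcons 4 (lcons f (lcons g 0))) (acons 0 l) v \<in> true_facts"
    if "Ev f l v \<in> true_facts \<and> Pr g \<in> true_facts" for f g l v
  proof -
    from that obtain p q where p: "f = encode p" "\<And>xs. l = args xs \<Longrightarrow> eval p xs = Some v"
      and q: "g = encode q"
      unfolding true_facts_iff by blast
    have "eval (Prec p q) xs = Some v" if "acons 0 l = args xs" for xs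
      using that p(2) unfolding acons_eq_args_iff by auto
    then show ?thesis unfolding true_facts_iff p(1) q encode_lcons(5)[symmetric] by blast
  qed
  show "Ev (lcons 4 (lcons f (lcons g 0))) (acons (Suc n) l) v \<in> true_facts"
    if "Ev (lcons 4 (lcons f (lcons g 0))) (acons n l) r \<in> true_facts \<and>
       Ev g (acons n (acons r l)) v \<in> true_facts" for f g n l r v
  proof -
    from that obtain p q where
      p: "lcons 4 (lcons f (lcons g 0)) = encode p" "\<And>xs. acons n l = args xs \<Longrightarrow> eval p xs = Some r"
      and q: "g = encode q" "\<And>xs. acons n (acons r l) = args xs \<Longrightarrow> eval q xs = Some v"
      unfolding true_facts_iff by blast
    obtain p' where p': "p = Prec p' q"
      using p(1) q(1) by (cases p) (auto simp: lcons_def encode_eq_iff)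
    have "eval p xs = Some v" if "acons (Suc n) l = args xs" for xs
    proof -
      from that obtain ys where ys: "xs = Suc n # ys" "l = args ys" by (auto simp: acons_eq_args_iff)
      show ?thesis
        using p(2)[of "n # ys"] q(2)[of "n # r # ys"] unfolding p' ys Prec_Suc
        by (simp del: eval.simps)
    qed
    then show ?thesis unfolding true_facts_iff p(1) by blast
  qed
  show "Ev (lcons 5 (lcons f 0)) l z \<in> true_facts"
    if "Ev f (acons z l) 0 \<in> true_facts \<and> (\<forall>y. y < z \<longrightarrow> (\<exists>v. Ev f (acons y l) (Suc v) \<in> true_facts))" for f l z
  proof -
    from that obtain p where p: "f = encode p" "\<And>xs. acons z l = args xs \<Longrightarrow> eval p xs = Some 0"
      unfolding true_facts_iff by blast
    have pos: "\<exists>v. \<forall>xs. acons y l = args xs \<longrightarrow> eval p xs = Some (Suc v)" if "y < z" for y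
      using that \<open>_ \<and> _\<close> unfolding true_facts_iff p(1) encode_eq_iff by blast
    have "eval (Mu p) xs = Some z" if "l = args xs" for xs
      using that p(2)[of "z # xs"] pos by (intro eval_Mu_eq_Some) force+
    then show ?thesis unfolding true_facts_iff p(1) encode_lcons(6)[symmetric] by blast
  qed
qed

lemma Re_closed_true_facts: "Re_closed true_facts"
  unfolding Re_closed_def
proof (intro conjI allI impI)
  show "Re (k + k) (lcons 0 (lcons k 0)) \<in> true_facts" for k
    unfolding true_facts_iff list_encode_pair[symmetric] by (rule pitts_J_base) (simp add: goal_set_def)
  show "Re (Suc (k + k)) (lcons 0 (lcons j 0)) \<in> true_facts" if "j \<noteq> k" for k j
    unfolding true_facts_iff list_encode_pair[symmetric] by (rule pitts_J_base) (use that in \<open>simp add: goal_set_def\<close>)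
  show "Re t (lcons 1 (lcons e 0)) \<in> true_facts"
    if "\<forall>m. n \<le> m \<longrightarrow> (\<exists>b. Ev e (acons m 0) b \<in> true_facts \<and> Re t b \<in> true_facts)" for t n e
    unfolding true_facts_iff list_encode_pair[symmetric]
  proof (rule pitts_J_step, intro allI impI)
    fix m assume "n \<le> m"
    with that obtain b where b: "Ev e (acons m 0) b \<in> true_facts" "b \<in> pitts_J (goal_set t)"
      unfolding true_facts_iff by blast
    then obtain p where "e = encode p" "eval p [m] = Some b"
      unfolding true_facts_iff by (metis args.simps)
    then show "\<exists>b\<in>pitts_J (goal_set t). phi e m = Some b" using b(2) by auto
  qed
qed

lemma Pr_in_closed: "Pr_closed X \<Longrightarrow> Pr (encode p) \<in> X"
proof (induction p)
  case (Comp f gs)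
  have "Prs (list_encode (map encode gs)) \<in> X"
    using Comp.IH(2) Comp.prems
  proof (induction gs)
    case Nil
    then show ?case by (simp add: Pr_closed_def)
  next
    case (Cons g gs)
    then have "Pr (encode g) \<in> X" "Prs (list_encode (map encode gs)) \<in> X" by simp_all
    then show ?case using Cons.prems(2) by (simp add: Pr_closed_def list_encode_Cons del: list_encode.simps)
  qed
  then show ?case using Comp.IH(1) Comp.prems unfolding encode_lcons Pr_closed_def by blast
qed (simp_all add: encode_lcons Pr_closed_def del: encode.simps)

lemma Ev_closedD:
  assumes "Ev_closed X"
  shows "Ev (lcons 0 0) l 0 \<in> X"
    and "Ev (lcons 1 0) (acons x l) (Suc x) \<in> X"
    and "Ev (lcons 2 (lcons 0 0)) (acons x l) x \<in> X"
    and "Ev (lcons 2 (lcons i 0)) l v \<in> X \<Longrightarrow> Ev (lcons 2 (lcons (Suc i) 0)) (acons x l) v \<in> X"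
    and "Evs 0 l 0 \<in> X"
    and "Ev g l y \<in> X \<Longrightarrow> Evs gs l ys \<in> X \<Longrightarrow> Evs (lcons g gs) l (acons y ys) \<in> X"
    and "Evs gs l ys \<in> X \<Longrightarrow> Ev f ys v \<in> X \<Longrightarrow> Ev (lcons 3 (lcons f gs)) l v \<in> X"
    and "Ev f l v \<in> X \<Longrightarrow> Pr g \<in> X \<Longrightarrow> Ev (lcons 4 (lcons f (lcons g 0))) (acons 0 l) v \<in> X"
    and "Ev (lcons 4 (lcons f (lcons g 0))) (acons n l) r \<in> X \<Longrightarrow>
       Ev g (acons n (acons r l)) v \<in> X \<Longrightarrow>
       Ev (lcons 4 (lcons f (lcons g 0))) (acons (Suc n) l) v \<in> X"
    and "Ev f (acons z l) 0 \<in> X \<Longrightarrow> \<forall>y. y < z \<longrightarrow> (\<exists>v. Ev f (acons y l) (Suc v) \<in> X) \<Longrightarrow>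
       Ev (lcons 5 (lcons f 0)) l z \<in> X"
proof -
  note c1 = assms[unfolded Ev_closed_def]
  note c2 = c1[THEN conjunct2]
  note c3 = c2[THEN conjunct2]
  note c4 = c3[THEN conjunct2]
  note c5 = c4[THEN conjunct2]
  note c6 = c5[THEN conjunct2]
  note c7 = c6[THEN conjunct2]
  note c8 = c7[THEN conjunct2]
  note c9 = c8[THEN conjunct2]
  note c10 = c9[THEN conjunct2]
  show "Ev (lcons 0 0) l 0 \<in> X"
    using c1[THEN conjunct1] by blast
  show "Ev (lcons 1 0) (acons x l) (Suc x) \<in> X"
    using c2[THEN conjunct1] by blast
  show "Ev (lcons 2 (lcons 0 0)) (acons x l) x \<in> X"
    using c3[THEN conjunct1] by blast
  show "Ev (lcons 2 (lcons i 0)) l v \<in> X \<Longrightarrow> Ev (lcons 2 (lcons (Suc i) 0)) (acons x l) v \<in> X"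
    using c4[THEN conjunct1] by blast
  show "Evs 0 l 0 \<in> X"
    using c5[THEN conjunct1] by blast
  show "Ev g l y \<in> X \<Longrightarrow> Evs gs l ys \<in> X \<Longrightarrow> Evs (lcons g gs) l (acons y ys) \<in> X"
    using c6[THEN conjunct1] by blast
  show "Evs gs l ys \<in> X \<Longrightarrow> Ev f ys v \<in> X \<Longrightarrow> Ev (lcons 3 (lcons f gs)) l v \<in> X"
    using c7[THEN conjunct1] by blast
  show "Ev f l v \<in> X \<Longrightarrow> Pr g \<in> X \<Longrightarrow> Ev (lcons 4 (lcons f (lcons g 0))) (acons 0 l) v \<in> X"
    using c8[THEN conjunct1] by blast
  show "Ev (lcons 4 (lcons f (lcons g 0))) (acons n l) r \<in> X \<Longrightarrow>
       Ev g (acons n (acons r l)) v \<in> X \<Longrightarrow>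
       Ev (lcons 4 (lcons f (lcons g 0))) (acons (Suc n) l) v \<in> X"
    using c9[THEN conjunct1] by blast
  show "Ev f (acons z l) 0 \<in> X \<Longrightarrow> \<forall>y. y < z \<longrightarrow> (\<exists>v. Ev f (acons y l) (Suc v) \<in> X) \<Longrightarrow>
       Ev (lcons 5 (lcons f 0)) l z \<in> X"
    using c10 by blast
qed

text \<open>Completeness of the rules for evaluation, by induction on the program.\<close>

lemma Ev_in_closed:
  assumes "Pr_closed X" and X: "Ev_closed X"
  shows "eval p xs = Some v \<Longrightarrow> Ev (encode p) (args xs) v \<in> X"
proof (induction p arbitrary: xs v)
  case Zero
  then show ?case using Ev_closedD(1)[OF X] unfolding encode_lcons by simp
next
  case Succ
  then obtain x ys where "xs = x # ys" "v = Suc x" by (cases xs) auto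
  then show ?case using Ev_closedD(2)[OF X] unfolding encode_lcons by simp
next
  case (Proj i)
  then have "i < length xs" "v = xs ! i" by (simp_all split: if_splits)
  then show ?case
  proof (induction xs arbitrary: i)
    case (Cons x xs)
    then show ?case
    proof (cases i)
      case 0
      then show ?thesis using Ev_closedD(3)[OF X] Cons.prems unfolding encode_lcons by simp
    next
      case (Suc j)
      then have "Ev (lcons 2 (lcons j 0)) (args xs) v \<in> X"
        using Cons.IH[of j] Cons.prems unfolding encode_lcons by simp
      then show ?thesis unfolding encode_lcons Suc args.simps by (rule Ev_closedD(4)[OF X])
    qed
  qed simp
next
  case (Comp f gs)
  from Comp.prems obtain ys where ys: "those (map (\<lambda>g. eval g xs) gs) = Some ys" "eval f ys = Some v"
    by (auto simp: bind_eq_Some_conv)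
  have "Evs (list_encode (map encode gs)) (args xs) (args ys) \<in> X"
    using Comp.IH(2) ys(1)
  proof (induction gs arbitrary: ys)
    case Nil
    then show ?case using Ev_closedD(5)[OF X] by simp
  next
    case (Cons g gs)
    from Cons.prems(2) obtain z zs where z: "ys = z # zs" "eval g xs = Some z"
      "those (map (\<lambda>g. eval g xs) gs) = Some zs"
      by (auto split: option.splits)
    have "Ev (encode g) (args xs) z \<in> X" using Cons.prems(1) z(2) by simp
    moreover have "Evs (list_encode (map encode gs)) (args xs) (args zs) \<in> X"
      using Cons.IH Cons.prems(1) z(3) by simp
    ultimately show ?case
      unfolding z(1) args.simps list.map list_encode_Cons by (rule Ev_closedD(6)[OF X])
  qed
  moreover have "Ev (encode f) (args ys) v \<in> X" using Comp.IH(1) ys(2) .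
  ultimately show ?case unfolding encode_lcons by (rule Ev_closedD(7)[OF X])
next
  case (Prec f g)
  obtain n ys where xs: "xs = n # ys" using Prec.prems by (cases xs) auto
  show ?case using Prec.prems unfolding xs
  proof (induction n arbitrary: v)
    case 0
    then have "Ev (encode f) (args ys) v \<in> X" using Prec.IH(1) by simp
    moreover have "Pr (encode g) \<in> X" using assms(1) by (rule Pr_in_closed)
    ultimately show ?case unfolding encode_lcons args.simps by (rule Ev_closedD(8)[OF X])
  next
    case (Suc n)
    from Suc.prems obtain r where r: "eval (Prec f g) (n # ys) = Some r" "eval g (n # r # ys) = Some v"
      unfolding Prec_Suc bind_eq_Some_conv by blast
    have "Ev (encode g) (acons n (acons r (args ys))) v \<in> X" using Prec.IH(2)[OF r(2)] by simp
    with Suc.IH[OF r(1)] show ?case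
      unfolding encode_lcons args.simps by (intro Ev_closedD(9)[OF X])
  qed
next
  case (Mu f)
  let ?P = "\<lambda>z. eval f (z # xs) = Some 0"
  from Mu.prems obtain z where z: "?P z" "\<forall>y<z. \<exists>v>0. eval f (y # xs) = Some v" and v: "v = Least ?P"
    by (auto split: if_splits)
  have "Least ?P = z" using z by (intro Least_equality) (auto simp: not_less[symmetric])
  then have "v = z" using v by simp
  have "\<forall>y. y < z \<longrightarrow> (\<exists>v. Ev (encode f) (acons y (args xs)) (Suc v) \<in> X)"
  proof (intro allI impI)
    fix y assume "y < z"
    with z(2) obtain u where "u > 0" "eval f (y # xs) = Some u" by blast
    then have "eval f (y # xs) = Some (Suc (u - 1))" by simp
    from Mu.IH[OF this] show "\<exists>v. Ev (encode f) (acons y (args xs)) (Suc v) \<in> X"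
      unfolding args.simps by (rule exI)
  qed
  moreover have "Ev (encode f) (acons z (args xs)) 0 \<in> X" using Mu.IH[OF z(1)] by simp
  ultimately show ?case
    unfolding encode_lcons \<open>v = z\<close> by (intro Ev_closedD(10)[OF X])
qed

text \<open>The numbers whose \<open>Re\<close> facts are in \<open>X\<close> satisfy the conditions that define \<open>J\<close> as an intersection.\<close>

lemma Re_in_closed:
  assumes "Pr_closed X" and "Ev_closed X" and X: "Re_closed X" and "b \<in> pitts_J (goal_set t)"
  shows "Re t b \<in> X"
proof -
  have "wedge {0} (goal_set t) \<subseteq> {b. Re t b \<in> X}"
  proof -
    have "Re t (lcons 0 (lcons a 0)) \<in> X" if "a \<in> goal_set t" for a
    proof (cases "even t")
      case True
      then have "t = a + a" using that by (auto simp: goal_set_def)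
      then show ?thesis using X unfolding Re_closed_def by blast
    next
      case False
      then obtain k where "t = Suc (k + k)" by (metis add_Suc_right odd_two_times_div_two_succ mult_2 Suc_eq_plus1)
      moreover from this have "a \<noteq> k" using that by (simp add: goal_set_def)
      ultimately show ?thesis using X unfolding Re_closed_def by blast
    qed
    then show ?thesis unfolding wedge_def list_encode_pair by blast
  qed
  moreover have "wedge {1} (pitts_F {b. Re t b \<in> X}) \<subseteq> {b. Re t b \<in> X}"
  proof -
    have "Re t (lcons 1 (lcons e 0)) \<in> X" if "e \<in> pitts_F {b. Re t b \<in> X}" for e
    proof -
      from that obtain n where n: "\<And>m. m \<ge> n \<Longrightarrow> \<exists>b. Re t b \<in> X \<and> phi e m = Some b"
        unfolding pitts_F_def arrow_def by auto
      have "\<exists>b. Ev e (acons m 0) b \<in> X \<and> Re t b \<in> X" if m: "n \<le> m" for m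
      proof -
        obtain b where b: "Re t b \<in> X" "phi e m = Some b" using n[OF m] by blast
        then obtain p where p: "e = encode p" unfolding phi_def by (auto split: if_splits)
        then have "Ev e (acons m 0) b \<in> X"
          using Ev_in_closed[OF assms(1,2), of p "[m]" b] b(2) by simp
        then show ?thesis using b(1) by blast
      qed
      then show ?thesis using X unfolding Re_closed_def by blast
    qed
    then show ?thesis unfolding wedge_def list_encode_pair by blast
  qed
  ultimately show ?thesis using assms(4) unfolding pitts_J_def by blast
qed

section \<open>The inductive definition in second-order arithmetic\<close>

definition Imp :: "fml \<Rightarrow> fml \<Rightarrow> fml" where "Imp p q = Neg (Conj p (Neg q))"
definition Ex :: "nat \<Rightarrow> fml \<Rightarrow> fml" where "Ex i p = Neg (All i (Neg p))"

fun num :: "nat \<Rightarrow> trm" where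
  "num 0 = TZero"
| "num (Suc n) = TSuc (num n)"

definition tpair :: "trm \<Rightarrow> trm \<Rightarrow> trm" where
  "tpair s t = TPlus (TTimes (TPlus s t) (TPlus s t)) s"
definition tacons :: "trm \<Rightarrow> trm \<Rightarrow> trm" where "tacons s t = TSuc (tpair s t)"

definition fEv :: "trm \<Rightarrow> trm \<Rightarrow> trm \<Rightarrow> fml" where
  "fEv c l v = Mem (tpair (num 0) (tpair c (tpair l v))) 0"
definition fEvs :: "trm \<Rightarrow> trm \<Rightarrow> trm \<Rightarrow> fml" where
  "fEvs c l v = Mem (tpair (num 1) (tpair c (tpair l v))) 0"
definition fPr :: "trm \<Rightarrow> fml" where "fPr c = Mem (tpair (num 2) c) 0"
definition fPrs :: "trm \<Rightarrow> fml" where "fPrs c = Mem (tpair (num 3) c) 0"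
definition fRe :: "trm \<Rightarrow> trm \<Rightarrow> fml" where "fRe t b = Mem (tpair (num 4) (tpair t b)) 0"

text \<open>Binds variable \<open>i\<close> to the value of \<open>lcons s t\<close>, which is no term of the language. The triangular number inside the pairing
  function is avoided by doubling the equation.\<close>

definition let_lcons :: "nat \<Rightarrow> trm \<Rightarrow> trm \<Rightarrow> fml \<Rightarrow> fml" where
  "let_lcons i s t p = All i (Imp (Eq (TPlus (TVar i) (TVar i))
    (TSuc (TSuc (TPlus (TTimes (TPlus s t) (TSuc (TPlus s t))) (TPlus s s))))) p)"

fun Conjs :: "fml list \<Rightarrow> fml" where
  "Conjs [] = Eq TZero TZero"
| "Conjs (p # ps) = Conj p (Conjs ps)"

lemmas fml_defs = Imp_def Ex_def tpair_def tacons_def fEv_def fEvs_def fPr_def fPrs_def fRe_def let_lcons_def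

lemma sat_Imp [simp]: "sat v S (Imp p q) \<longleftrightarrow> (sat v S p \<longrightarrow> sat v S q)"
  and sat_Ex [simp]: "sat v S (Ex i p) \<longleftrightarrow> (\<exists>x. sat (v(i := x)) S p)"
  by (auto simp: fml_defs)

lemma trm_val_num [simp]: "trm_val v (num n) = n"
  by (induction n) auto

lemma trm_vars_num [simp]: "trm_vars (num n) = {}"
  by (induction n) auto

lemma trm_val_tacons [simp]: "trm_val v (tacons s t) = acons (trm_val v s) (trm_val v t)"
  by (simp add: fml_defs acons_def qpair_def)

lemma sat_facts [simp]:
  "sat v S (fEv c l w) \<longleftrightarrow> Ev (trm_val v c) (trm_val v l) (trm_val v w) \<in> S 0"
  "sat v S (fEvs c l w) \<longleftrightarrow> Evs (trm_val v c) (trm_val v l) (trm_val v w) \<in> S 0"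
  "sat v S (fPr c) \<longleftrightarrow> Pr (trm_val v c) \<in> S 0"
  "sat v S (fPrs c) \<longleftrightarrow> Prs (trm_val v c) \<in> S 0"
  "sat v S (fRe s t) \<longleftrightarrow> Re (trm_val v s) (trm_val v t) \<in> S 0"
  by (simp_all add: fml_defs fact_defs qpair_def del: One_nat_def)

lemma trm_val_upd: "i \<notin> trm_vars t \<Longrightarrow> trm_val (v(i := x)) t = trm_val v t"
  by (induction t) auto

lemma eq_lcons_iff: "z = lcons a l \<longleftrightarrow> z + z = Suc (Suc ((a + l) * Suc (a + l) + (a + a)))"
proof -
  have "triangle n + triangle n = n * Suc n" for n
    by (induction n) auto
  then have "lcons a l + lcons a l = Suc (Suc ((a + l) * Suc (a + l) + (a + a)))"
    unfolding lcons_def prod_encode_def by simp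
  then show ?thesis by linarith
qed

lemma sat_let_lcons [simp]:
  assumes "i \<notin> trm_vars s" and "i \<notin> trm_vars t"
  shows "sat v S (let_lcons i s t p) \<longleftrightarrow> sat (v(i := lcons (trm_val v s) (trm_val v t))) S p"
proof -
  have "sat v S (let_lcons i s t p) \<longleftrightarrow>
    (\<forall>z. z = lcons (trm_val v s) (trm_val v t) \<longrightarrow> sat (v(i := z)) S p)"
    unfolding eq_lcons_iff using assms by (simp add: let_lcons_def trm_val_upd)
  then show ?thesis by simp
qed

text \<open>The following three formulas spell out \<open>Pr_closed\<close>, \<open>Ev_closed\<close> and \<open>Re_closed\<close>, quantifier by quantifier in
  the same order. Number variable 0 is left for the input.\<close>

definition Pr_closed_fml :: fml where
  "Pr_closed_fml = Conjs [
    let_lcons 1 (num 0) (num 0) (fPr (TVar 1)),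
    let_lcons 1 (num 1) (num 0) (fPr (TVar 1)),
    All 1 (let_lcons 2 (TVar 1) (num 0) (let_lcons 3 (num 2) (TVar 2) (fPr (TVar 3)))),
    fPrs (num 0),
    All 1 (All 2 (Imp (Conj (fPr (TVar 1)) (fPrs (TVar 2)))
       (let_lcons 3 (TVar 1) (TVar 2) (fPrs (TVar 3))))),
    All 1 (All 2 (Imp (Conj (fPr (TVar 1)) (fPrs (TVar 2)))
       (let_lcons 3 (TVar 1) (TVar 2) (let_lcons 4 (num 3) (TVar 3) (fPr (TVar 4)))))),
    All 1 (All 2 (Imp (Conj (fPr (TVar 1)) (fPr (TVar 2)))
       (let_lcons 3 (TVar 2) (num 0) (let_lcons 4 (TVar 1) (TVar 3)
         (let_lcons 5 (num 4) (TVar 4) (fPr (TVar 5))))))),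
    All 1 (Imp (fPr (TVar 1))
       (let_lcons 2 (TVar 1) (num 0) (let_lcons 3 (num 5) (TVar 2) (fPr (TVar 3)))))]"

lemma sat_Pr_closed_fml: "sat v S Pr_closed_fml \<longleftrightarrow> Pr_closed (S 0)"
  unfolding Pr_closed_fml_def Pr_closed_def by simp

definition Ev_closed_fml :: fml where
  "Ev_closed_fml = Conjs [
    All 1 (let_lcons 2 (num 0) (num 0) (fEv (TVar 2) (TVar 1) (num 0))),
    All 1 (All 2 (let_lcons 3 (num 1) (num 0)
       (fEv (TVar 3) (tacons (TVar 1) (TVar 2)) (TSuc (TVar 1))))),
    All 1 (All 2 (let_lcons 3 (num 0) (num 0) (let_lcons 4 (num 2) (TVar 3)
       (fEv (TVar 4) (tacons (TVar 1) (TVar 2)) (TVar 1))))),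
    All 1 (All 2 (All 3 (All 4
       (let_lcons 5 (TVar 1) (num 0) (let_lcons 6 (num 2) (TVar 5)
       (let_lcons 7 (TSuc (TVar 1)) (num 0) (let_lcons 8 (num 2) (TVar 7)
         (Imp (fEv (TVar 6) (TVar 3) (TVar 4))
           (fEv (TVar 8) (tacons (TVar 2) (TVar 3)) (TVar 4)))))))))),
    All 1 (fEvs (num 0) (TVar 1) (num 0)),
    All 1 (All 2 (All 3 (All 4 (All 5
       (let_lcons 6 (TVar 1) (TVar 2)
         (Imp (Conj (fEv (TVar 1) (TVar 3) (TVar 4)) (fEvs (TVar 2) (TVar 3) (TVar 5)))
           (fEvs (TVar 6) (TVar 3) (tacons (TVar 4) (TVar 5))))))))),
    All 1 (All 2 (All 3 (All 4 (All 5
       (let_lcons 6 (TVar 1) (TVar 2) (let_lcons 7 (num 3) (TVar 6)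
         (Imp (Conj (fEvs (TVar 2) (TVar 3) (TVar 4)) (fEv (TVar 1) (TVar 4) (TVar 5)))
           (fEv (TVar 7) (TVar 3) (TVar 5))))))))),
    All 1 (All 2 (All 3 (All 4
       (let_lcons 5 (TVar 2) (num 0) (let_lcons 6 (TVar 1) (TVar 5) (let_lcons 7 (num 4) (TVar 6)
         (Imp (Conj (fEv (TVar 1) (TVar 3) (TVar 4)) (fPr (TVar 2)))
           (fEv (TVar 7) (tacons (num 0) (TVar 3)) (TVar 4))))))))),
    All 1 (All 2 (All 3 (All 4 (All 5 (All 6
       (let_lcons 7 (TVar 2) (num 0) (let_lcons 8 (TVar 1) (TVar 7) (let_lcons 9 (num 4) (TVar 8)
         (Imp (Conj (fEv (TVar 9) (tacons (TVar 3) (TVar 4)) (TVar 5))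
             (fEv (TVar 2) (tacons (TVar 3) (tacons (TVar 5) (TVar 4))) (TVar 6)))
           (fEv (TVar 9) (tacons (TSuc (TVar 3)) (TVar 4)) (TVar 6))))))))))),
    All 1 (All 2 (All 3
       (let_lcons 4 (TVar 1) (num 0) (let_lcons 5 (num 5) (TVar 4)
         (Imp (Conj (fEv (TVar 1) (tacons (TVar 3) (TVar 2)) (num 0))
             (All 6 (Imp (Less (TVar 6) (TVar 3))
               (Ex 7 (fEv (TVar 1) (tacons (TVar 6) (TVar 2)) (TSuc (TVar 7)))))))
           (fEv (TVar 5) (TVar 2) (TVar 3)))))))]"

lemma sat_Ev_closed_fml: "sat v S Ev_closed_fml \<longleftrightarrow> Ev_closed (S 0)"
  unfolding Ev_closed_fml_def Ev_closed_def by simp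

definition Re_closed_fml :: fml where
  "Re_closed_fml = Conjs [
    All 1 (let_lcons 2 (TVar 1) (num 0) (let_lcons 3 (num 0) (TVar 2)
       (fRe (TPlus (TVar 1) (TVar 1)) (TVar 3)))),
    All 1 (All 2 (Imp (Neg (Eq (TVar 2) (TVar 1)))
       (let_lcons 3 (TVar 2) (num 0) (let_lcons 4 (num 0) (TVar 3)
         (fRe (TSuc (TPlus (TVar 1) (TVar 1))) (TVar 4)))))),
    All 1 (All 2 (All 3
       (Imp (All 4 (Imp (Neg (Less (TVar 4) (TVar 2)))
           (Ex 5 (Conj (fEv (TVar 3) (tacons (TVar 4) (num 0)) (TVar 5)) (fRe (TVar 1) (TVar 5))))))
         (let_lcons 6 (TVar 3) (num 0) (let_lcons 7 (num 1) (TVar 6) (fRe (TVar 1) (TVar 7)))))))]"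

lemma sat_Re_closed_fml: "sat v S Re_closed_fml \<longleftrightarrow> Re_closed (S 0)"
  unfolding Re_closed_fml_def Re_closed_def by (simp add: not_less)

definition rule_closed :: "nat set \<Rightarrow> bool" where
  "rule_closed X \<longleftrightarrow> Pr_closed X \<and> Ev_closed X \<and> Re_closed X"

definition rule_closed_fml :: fml where
  "rule_closed_fml = Conj Pr_closed_fml (Conj Ev_closed_fml Re_closed_fml)"

lemma fml_syntax [simp]:
  "free_num_vars (Imp p q) = free_num_vars p \<union> free_num_vars q"
  "free_num_vars (Ex i p) = free_num_vars p - {i}"
  "free_num_vars (let_lcons i s t p) = (trm_vars s \<union> trm_vars t \<union> free_num_vars p) - {i}"
  "free_num_vars (fEv c l w) = trm_vars c \<union> trm_vars l \<union> trm_vars w"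
  "free_num_vars (fEvs c l w) = trm_vars c \<union> trm_vars l \<union> trm_vars w"
  "free_num_vars (fPr c) = trm_vars c" "free_num_vars (fPrs c) = trm_vars c"
  "free_num_vars (fRe s t) = trm_vars s \<union> trm_vars t"
  "trm_vars (tacons s t) = trm_vars s \<union> trm_vars t"
  "free_set_vars (Imp p q) = free_set_vars p \<union> free_set_vars q"
  "free_set_vars (Ex i p) = free_set_vars p"
  "free_set_vars (let_lcons i s t p) = free_set_vars p"
  "free_set_vars (fEv c l w) = {0}" "free_set_vars (fEvs c l w) = {0}"
  "free_set_vars (fPr c) = {0}" "free_set_vars (fPrs c) = {0}" "free_set_vars (fRe s t) = {0}"
  "arithmetical (Imp p q) \<longleftrightarrow> arithmetical p \<and> arithmetical q"
  "arithmetical (Ex i p) \<longleftrightarrow> arithmetical p"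
  "arithmetical (let_lcons i s t p) \<longleftrightarrow> arithmetical p"
  "arithmetical (fEv c l w)" "arithmetical (fEvs c l w)"
  "arithmetical (fPr c)" "arithmetical (fPrs c)" "arithmetical (fRe s t)"
  by (auto simp: fml_defs)

lemma rule_closed_fml_syntax:
  "arithmetical rule_closed_fml" "free_num_vars rule_closed_fml = {}" "free_set_vars rule_closed_fml = {0}"
  unfolding rule_closed_fml_def Pr_closed_fml_def Ev_closed_fml_def Re_closed_fml_def
  by (simp_all add: insert_Diff_if)

lemma sat_rule_closed_fml: "sat v S rule_closed_fml \<longleftrightarrow> rule_closed (S 0)"
  by (simp add: rule_closed_fml_def rule_closed_def sat_Pr_closed_fml sat_Ev_closed_fml sat_Re_closed_fml)

text \<open>This is used with formulas \<open>p\<close> that are positive in the set variable, for which truth in all closed sets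
  amounts to truth in the least one.\<close>

lemma Pi11_if_true_in_rule_closed:
  assumes "arithmetical p" and "free_num_vars p \<subseteq> {0}" and "free_set_vars p \<subseteq> {0}"
    and "\<And>x. x \<in> A \<longleftrightarrow> (\<forall>X. rule_closed X \<longrightarrow> sat ((\<lambda>_. 0)(0 := x)) ((\<lambda>_. {})(0 := X)) p)"
  shows "Pi11 A"
  unfolding Pi11_def
proof (intro exI[of _ "Imp rule_closed_fml p"] conjI)
  show "A = {x. sat ((\<lambda>_. 0)(0 := x)) (\<lambda>_. {}) (AllSet 0 (Imp rule_closed_fml p))}"
    using assms(4) by (auto simp: sat_rule_closed_fml)
qed (use assms(1-3) rule_closed_fml_syntax in auto)

section \<open>Representable functions are hyperarithmetical\<close>

text \<open>According to \<open>X\<close>, program \<open>e\<close> maps \<open>n\<close> to an element of \<open>J (goal_set t)\<close>. The existential form is monotone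
  in \<open>X\<close>, so that it passes from the true facts to all closed sets.\<close>

definition hits :: "nat set \<Rightarrow> nat \<Rightarrow> nat \<Rightarrow> nat \<Rightarrow> bool" where
  "hits X e n t \<longleftrightarrow> (\<exists>b. Ev e (acons n 0) b \<in> X \<and> Re t b \<in> X)"

definition hits_fml :: "nat \<Rightarrow> trm \<Rightarrow> trm \<Rightarrow> fml" where
  "hits_fml e n t = Ex 1 (Conj (fEv (num e) (tacons n (num 0)) (TVar 1)) (fRe t (TVar 1)))"

lemma sat_hits_fml [simp]:
  "1 \<notin> trm_vars n \<Longrightarrow> 1 \<notin> trm_vars t \<Longrightarrow>
    sat v S (hits_fml e n t) \<longleftrightarrow> hits (S 0) e (trm_val v n) (trm_val v t)"
  by (simp add: hits_fml_def hits_def trm_val_upd)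

lemma hits_if_in_pitts_J:
  assumes "rule_closed X" and "phi e n = Some a" and "a \<in> pitts_J (goal_set t)"
  shows "hits X e n t"
proof -
  obtain p where p: "e = encode p" using assms(2) unfolding phi_def by (auto split: if_splits)
  then have "Ev e (acons n 0) a \<in> X"
    using Ev_in_closed[of X p "[n]" a] assms(1,2) by (simp add: rule_closed_def)
  then show ?thesis using Re_in_closed assms(1,3) unfolding hits_def rule_closed_def by blast
qed

lemma in_pitts_J_if_hits:
  assumes "hits true_facts e n t" and "phi e n = Some a"
  shows "a \<in> pitts_J (goal_set t)"
proof -
  obtain b where b: "Ev e (acons n 0) b \<in> true_facts" "b \<in> pitts_J (goal_set t)"
    using assms(1) unfolding hits_def true_facts_iff by blast
  then obtain p where "e = encode p" "eval p [n] = Some b"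
    unfolding true_facts_iff by (metis args.simps)
  then show ?thesis using assms(2) b(2) by simp
qed

lemma rule_closed_true_facts: "rule_closed true_facts"
  by (simp add: rule_closed_def Pr_closed_true_facts Ev_closed_true_facts Re_closed_true_facts)

lemma goal_set_simps [simp]: "goal_set (k + k) = {k}" "goal_set (Suc (k + k)) = - {k}"
  by (simp_all add: goal_set_def mult_2[symmetric])

text \<open>Both \<open>A\<close> and its complement are of the form \<open>{x. F x \<in> J {k}}\<close>, because \<open>J {0}\<close> and \<open>J {1}\<close> are disjoint.\<close>

lemma J_decidable_imp_hyperarithmetical:
  assumes "J_decidable A"
  shows "hyperarithmetical A"
proof -
  obtain F e where e: "\<And>n. phi e n = Some (F n)"
    and F: "\<And>n. n \<in> A \<Longrightarrow> F n \<in> pitts_J {0}" "\<And>n. n \<notin> A \<Longrightarrow> F n \<in> pitts_J {1}"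
    using assms unfolding J_decidable_def total_recursive_def by blast
  have Pi11: "Pi11 {x. F x \<in> pitts_J {k}}" for k
  proof (rule Pi11_if_true_in_rule_closed[of "hits_fml e (TVar 0) (num (k + k))"])
    show "x \<in> {x. F x \<in> pitts_J {k}} \<longleftrightarrow> (\<forall>X. rule_closed X \<longrightarrow>
        sat ((\<lambda>_. 0)(0 := x)) ((\<lambda>_. {})(0 := X)) (hits_fml e (TVar 0) (num (k + k))))" for x
      using hits_if_in_pitts_J[OF _ e, of _ x "k + k"] in_pitts_J_if_hits[OF _ e, of x "k + k"]
        rule_closed_true_facts by auto
  qed (simp_all add: hits_fml_def)
  have "pitts_J {0} \<inter> pitts_J {1} = {}" by (rule pitts_J_disjoint) simp
  then have "A = {x. F x \<in> pitts_J {0}}" "- A = {x. F x \<in> pitts_J {1}}" using F by blast+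
  then show ?thesis unfolding hyperarithmetical_def Sigma11_def using Pi11 by metis
qed

text \<open>The complement of the graph is not treated as ``some other value is realized'', which would put a number
  quantifier in front of the set quantifier, but as ``a value in \<open>- {k}\<close> is realized''.\<close>

lemma J_representable_imp_hyperarithmetical_fun:
  assumes "J_representable f"
  shows "hyperarithmetical_fun f"
proof -
  obtain F e where e: "\<And>n. phi e n = Some (F n)" and F: "\<And>n. F n \<in> pitts_J {f n}"
    using assms unfolding J_representable_def total_recursive_def by blast
  have eq: "F n \<in> pitts_J {k} \<longleftrightarrow> f n = k" for n k
    using F[of n] pitts_J_disjoint[of "{k}" "{f n}"] by auto
  have neq: "F n \<in> pitts_J (- {k}) \<longleftrightarrow> f n \<noteq> k" for n k
    using F[of n] pitts_J_disjoint[of "- {k}" "{f n}"] pitts_J_mono[of "{f n}" "- {k}"] by auto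
  let ?G = "{list_encode [n, f n] | n. True}"
  let ?is_pair = "\<lambda>p. let_lcons 4 (TVar 3) (num 0) (let_lcons 5 (TVar 2) (TVar 4) (p (Eq (TVar 0) (TVar 5))))"
  have "Pi11 ?G"
  proof (rule Pi11_if_true_in_rule_closed[of "Ex 2 (Ex 3 (?is_pair (\<lambda>q. Conj q
      (hits_fml e (TVar 2) (TPlus (TVar 3) (TVar 3))))))"])
    show "x \<in> ?G \<longleftrightarrow> (\<forall>X. rule_closed X \<longrightarrow> sat ((\<lambda>_. 0)(0 := x)) ((\<lambda>_. {})(0 := X))
      (Ex 2 (Ex 3 (?is_pair (\<lambda>q. Conj q (hits_fml e (TVar 2) (TPlus (TVar 3) (TVar 3))))))))" for x
    proof -
      have "x \<in> ?G \<longleftrightarrow> (\<forall>X. rule_closed X \<longrightarrow> (\<exists>n k. x = lcons n (lcons k 0) \<and> hits X e n (k + k)))"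
      proof
        assume "x \<in> ?G"
        then obtain n where "x = lcons n (lcons (f n) 0)" unfolding list_encode_pair by blast
        moreover have "hits X e n (f n + f n)" if "rule_closed X" for X
          using hits_if_in_pitts_J[OF that e, of n "f n + f n"] F by simp
        ultimately show "\<forall>X. rule_closed X \<longrightarrow> (\<exists>n k. x = lcons n (lcons k 0) \<and> hits X e n (k + k))"
          by blast
      next
        assume "\<forall>X. rule_closed X \<longrightarrow> (\<exists>n k. x = lcons n (lcons k 0) \<and> hits X e n (k + k))"
        then obtain n k where "x = lcons n (lcons k 0)" "hits true_facts e n (k + k)"
          using rule_closed_true_facts by blast
        moreover from this have "f n = k" using in_pitts_J_if_hits[OF _ e, of n "k + k"] eq by simp
        ultimately show "x \<in> ?G" unfolding list_encode_pair by blast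
      qed
      then show ?thesis by simp
    qed
  qed (auto simp: hits_fml_def)
  moreover have "Pi11 (- ?G)"
  proof (rule Pi11_if_true_in_rule_closed[of "All 2 (All 3 (?is_pair (\<lambda>q. Imp q
      (hits_fml e (TVar 2) (TSuc (TPlus (TVar 3) (TVar 3)))))))"])
    show "x \<in> - ?G \<longleftrightarrow> (\<forall>X. rule_closed X \<longrightarrow> sat ((\<lambda>_. 0)(0 := x)) ((\<lambda>_. {})(0 := X))
      (All 2 (All 3 (?is_pair (\<lambda>q. Imp q (hits_fml e (TVar 2) (TSuc (TPlus (TVar 3) (TVar 3)))))))))" for x
    proof -
      have "x \<in> - ?G \<longleftrightarrow>
        (\<forall>X. rule_closed X \<longrightarrow> (\<forall>n k. x = lcons n (lcons k 0) \<longrightarrow> hits X e n (Suc (k + k))))"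
      proof
        assume x: "x \<in> - ?G"
        have "hits X e n (Suc (k + k))" if "rule_closed X" "x = lcons n (lcons k 0)" for X n k
        proof -
          have "f n \<noteq> k" using x that(2) unfolding list_encode_pair by auto
          then show ?thesis using hits_if_in_pitts_J[OF that(1) e, of n "Suc (k + k)"] neq by simp
        qed
        then show "\<forall>X. rule_closed X \<longrightarrow> (\<forall>n k. x = lcons n (lcons k 0) \<longrightarrow> hits X e n (Suc (k + k)))"
          by blast
      next
        assume "\<forall>X. rule_closed X \<longrightarrow> (\<forall>n k. x = lcons n (lcons k 0) \<longrightarrow> hits X e n (Suc (k + k)))"
        then have "\<And>n k. x = lcons n (lcons k 0) \<Longrightarrow> hits true_facts e n (Suc (k + k))"
          using rule_closed_true_facts by blast
        then have "f n \<noteq> k" if "x = lcons n (lcons k 0)" for n k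
          using in_pitts_J_if_hits[OF _ e, of n "Suc (k + k)"] that neq by simp
        then show "x \<in> - ?G" unfolding list_encode_pair by blast
      qed
      then show ?thesis by simp
    qed
  qed (auto simp: hits_fml_def)
  ultimately show ?thesis
    by (simp add: hyperarithmetical_fun_def hyperarithmetical_def Sigma11_def)
qed

theorem theorem2p2:
  "{A :: nat set. J_decidable A} = {A. hyperarithmetical A} \<and>
   {f :: nat \<Rightarrow> nat. J_representable f} = {f. hyperarithmetical_fun f}"
  using J_decidable_imp_hyperarithmetical hyperarithmetical_imp_J_decidable
    J_representable_imp_hyperarithmetical_fun hyperarithmetical_fun_imp_J_representable
  by blast

end
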